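(* Let $\psi$ be a $\mathcal{T}$-formula in d-DNNF which is $\mathcal{T}$-reduced with respect to a finite set of atoms $\boldsymbol{\alpha}$ containing its atoms, and let $\beta$ be a clause on $\boldsymbol{\alpha}$. Then: (a) the $\mathcal{T}$-satisfiability of $\psi$ can be decided in time polynomial in the size of $\psi$; (b) whether $\psi\models_{\mathcal{T}}\beta$ can be decided in time polynomial in the sizes of $\psi$ and $\beta$; (c) $\#\mathrm{SMT}(\psi)$ can be computed in time polynomial in the size of $\psi$; (d) $\mathrm{AllSMT}(\psi)$ can be computed in time polynomial in the size of $\psi$ and the size of the output set.
   Context: $\mathcal{T}$-formulas are quantifier-free formulas built by Boolean connectives from $\mathcal{T}$-atoms and Boolean atoms, represented as DAGs (identical subformulas shared); size is the number of DAG nodes. The Boolean abstraction maps each atom bijectively to a fresh Boolean variable; $\psi\models_p\chi$ means the abstraction of $\psi$ propositionally entails that of $\chi$. A formula is in NNF if its internal nodes are only $\wedge,\vee$ with negations only on atoms; it is decomposable if the children of every $\wedge$-node share no atoms, deterministic if the children of every $\vee$-node are pairwise propositionally inconsistent; d-DNNF = decomposable and deterministic NNF. A $\mathcal{T}$-formula is in d-DNNF iff its Boolean abstraction is. A total truth assignment on $\boldsymbol{\alpha}$ is a conjunction containing, for each $a\in\boldsymbol{\alpha}$, exactly one of $a,\neg a$. $H_{\boldsymbol{\alpha}}(\psi)$ (resp. $P_{\boldsymbol{\alpha}}(\psi)$) is the set of $\mathcal{T}$-satisfiable (resp. $\mathcal{T}$-unsatisfiable) total truth assignments $\eta$ on $\boldsymbol{\alpha}$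 with $\eta\models_p\psi$; $\psi$ is $\mathcal{T}$-reduced with respect to $\boldsymbol{\alpha}$ iff $P_{\boldsymbol{\alpha}}(\psi)=\emptyset$. $\#\mathrm{SMT}(\psi)=|H_{\boldsymbol{\alpha}}(\psi)|$ and $\mathrm{AllSMT}(\psi)=H_{\boldsymbol{\alpha}}(\psi)$.
   Formalization: In (c) the time is polynomial in the size of ψ plus the number of atoms of α not occurring in ψ; with the size of ψ alone the claim fails (ψ = A, α = {A, B1, …, Bn} Boolean atoms: the count 2^n has n+1 bits). *)

theory Defs
  imports "HOL-Library.FSet" "HOL-Computational_Algebra.Polynomial"
begin

section \<open>Formulas as shared DAGs\<close>

text \<open>
  Conjunction and disjunction take finite sets of children; the constants true and false are
  \<open>And {||}\<close> and \<open>Or {||}\<close>.  Since identical subformulas are shared, the nodes of the DAG of a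
  formula are exactly its distinct subformulas.
\<close>

datatype (atoms: 'a) form =
    Atom 'a
  | Neg "'a form"
  | And "'a form fset"
  | Or "'a form fset"
  | Imp "'a form" "'a form"
  | Iff "'a form" "'a form"

primrec subforms :: "'a form \<Rightarrow> 'a form set" where
  "subforms (Atom a) = {Atom a}"
| "subforms (Neg f) = insert (Neg f) (subforms f)"
| "subforms (And S) = insert (And S) (\<Union>(fset (subforms |`| S)))"
| "subforms (Or S) = insert (Or S) (\<Union>(fset (subforms |`| S)))"
| "subforms (Imp f g) = insert (Imp f g) (subforms f \<union> subforms g)"
| "subforms (Iff f g) = insert (Iff f g) (subforms f \<union> subforms g)"

lemma finite_subforms: "finite (subforms f)"
  by (induction f) auto

definition dag_size :: "'a form \<Rightarrow> nat" where
  "dag_size f = card (subforms f)"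

fun children :: "'a form \<Rightarrow> 'a form set" where
  "children (Atom a) = {}"
| "children (Neg f) = {f}"
| "children (And S) = fset S"
| "children (Or S) = fset S"
| "children (Imp f g) = {f, g}"
| "children (Iff f g) = {f, g}"

text \<open>
  Propositional semantics.  Each atom is identified with the Boolean variable abstracting it, so
  the abstraction of a formula over \<open>'a\<close> is evaluated under arbitrary valuations of \<open>'a\<close>.
\<close>

primrec sat :: "('a \<Rightarrow> bool) \<Rightarrow> 'a form \<Rightarrow> bool" where
  "sat v (Atom a) \<longleftrightarrow> v a"
| "sat v (Neg f) \<longleftrightarrow> \<not> sat v f"
| "sat v (And S) \<longleftrightarrow> (\<forall>b |\<in>| sat v |`| S. b)"
| "sat v (Or S) \<longleftrightarrow> (\<exists>b |\<in>| sat v |`| S. b)"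
| "sat v (Imp f g) \<longleftrightarrow> (sat v f \<longrightarrow> sat v g)"
| "sat v (Iff f g) \<longleftrightarrow> (sat v f \<longleftrightarrow> sat v g)"

definition prop_entails :: "'a form \<Rightarrow> 'a form \<Rightarrow> bool"  (infix \<open>\<Turnstile>\<^sub>p\<close> 50) where
  "f \<Turnstile>\<^sub>p g \<longleftrightarrow> (\<forall>v. sat v f \<longrightarrow> sat v g)"

section \<open>d-DNNF\<close>

fun is_literal :: "'a form \<Rightarrow> bool" where
  "is_literal (Atom a) = True"
| "is_literal (Neg (Atom a)) = True"
| "is_literal _ = False"

definition nnf :: "'a form \<Rightarrow> bool" where
  "nnf f \<longleftrightarrow> (\<forall>g \<in> subforms f. is_literal g \<or> (\<exists>S. g = And S) \<or> (\<exists>S. g = Or S))"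

definition decomposable :: "'a form \<Rightarrow> bool" where
  "decomposable f \<longleftrightarrow>
     (\<forall>S. And S \<in> subforms f \<longrightarrow>
        (\<forall>g |\<in>| S. \<forall>h |\<in>| S. g \<noteq> h \<longrightarrow> atoms g \<inter> atoms h = {}))"

definition deterministic :: "'a form \<Rightarrow> bool" where
  "deterministic f \<longleftrightarrow>
     (\<forall>S. Or S \<in> subforms f \<longrightarrow>
        (\<forall>g |\<in>| S. \<forall>h |\<in>| S. g \<noteq> h \<longrightarrow> \<not> (\<exists>v. sat v g \<and> sat v h)))"

definition d_DNNF :: "'a form \<Rightarrow> bool" where
  "d_DNNF f \<longleftrightarrow> nnf f \<and> decomposable f \<and> deterministic f"

definition total_assignment :: "'a set \<Rightarrow> 'a form \<Rightarrow> bool" where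
  "total_assignment \<alpha> \<eta> \<longleftrightarrow>
     (\<exists>S. \<eta> = And S \<and> (\<forall>l |\<in>| S. is_literal l \<and> atoms l \<subseteq> \<alpha>) \<and>
          (\<forall>a \<in> \<alpha>. (Atom a |\<in>| S) \<noteq> (Neg (Atom a) |\<in>| S)))"

definition clause_on :: "'a set \<Rightarrow> 'a form \<Rightarrow> bool" where
  "clause_on \<alpha> \<beta> \<longleftrightarrow> (\<exists>S. \<beta> = Or S \<and> (\<forall>l |\<in>| S. is_literal l \<and> atoms l \<subseteq> \<alpha>))"

section \<open>Satisfiability modulo a theory\<close>

text \<open>
  A theory is given by its interpretations, i.e. its models together with values for the free
  variables occurring in theory atoms, and by the truth of theory atoms in them.  Nothing is
  assumed about the syntax of theory atoms or about the decidability of the theory.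
  Boolean atoms are not constrained by the theory.
\<close>

datatype ('m, 't) smt_theory = Smt_Theory (interps: "'m set") (holds: "'m \<Rightarrow> 't \<Rightarrow> bool")

datatype ('t, 'b) atom = TAtom 't | BAtom 'b

primrec truth :: "('m, 't) smt_theory \<Rightarrow> 'm \<Rightarrow> ('b \<Rightarrow> bool) \<Rightarrow> ('t, 'b) atom \<Rightarrow> bool" where
  "truth T M b (TAtom t) = holds T M t"
| "truth T M b (BAtom x) = b x"

definition T_sat :: "('m, 't) smt_theory \<Rightarrow> ('t, 'b) atom form \<Rightarrow> bool" where
  "T_sat T f \<longleftrightarrow> (\<exists>M \<in> interps T. \<exists>b. sat (truth T M b) f)"

definition T_entails ::
  "('m, 't) smt_theory \<Rightarrow> ('t, 'b) atom form \<Rightarrow> ('t, 'b) atom form \<Rightarrow> bool" where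
  "T_entails T f g \<longleftrightarrow>
     (\<forall>M \<in> interps T. \<forall>b. sat (truth T M b) f \<longrightarrow> sat (truth T M b) g)"

definition H_assignments :: "('m, 't) smt_theory \<Rightarrow> ('t, 'b) atom set \<Rightarrow> ('t, 'b) atom form
    \<Rightarrow> ('t, 'b) atom form set" where
  "H_assignments T \<alpha> f = {\<eta>. total_assignment \<alpha> \<eta> \<and> T_sat T \<eta> \<and> \<eta> \<Turnstile>\<^sub>p f}"

definition P_assignments :: "('m, 't) smt_theory \<Rightarrow> ('t, 'b) atom set \<Rightarrow> ('t, 'b) atom form
    \<Rightarrow> ('t, 'b) atom form set" where
  "P_assignments T \<alpha> f = {\<eta>. total_assignment \<alpha> \<eta> \<and> \<not> T_sat T \<eta> \<and> \<eta> \<Turnstile>\<^sub>p f}"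

definition T_reduced ::
  "('m, 't) smt_theory \<Rightarrow> ('t, 'b) atom set \<Rightarrow> ('t, 'b) atom form \<Rightarrow> bool" where
  "T_reduced T \<alpha> f \<longleftrightarrow> P_assignments T \<alpha> f = {}"

definition AllSMT :: "('m, 't) smt_theory \<Rightarrow> ('t, 'b) atom set \<Rightarrow> ('t, 'b) atom form
    \<Rightarrow> ('t, 'b) atom form set" where
  "AllSMT T \<alpha> f = H_assignments T \<alpha> f"

definition count_SMT ::
  "('m, 't) smt_theory \<Rightarrow> ('t, 'b) atom set \<Rightarrow> ('t, 'b) atom form \<Rightarrow> nat" where
  "count_SMT T \<alpha> f = card (H_assignments T \<alpha> f)"

section \<open>Machine model\<close>

text \<open>
  A first-order Lisp: data are S-expressions over symbols, and a program is a finite list of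
  function bodies, the first one being the main function.  Evaluation is call by value, and
  every evaluation step costs one unit.  A step allocates at most one pair, and only
  symbols and \<open>NilD\<close> can be compared (\<open>EqE\<close>), so up to the names of the symbols, which are the
  atoms, the model is polynomially equivalent to Turing machines.  Programs contain no symbols,
  hence can only copy and compare those of their input.  Variables are de Bruijn indices.
\<close>

datatype 'a data = NilD | Sym 'a | PairD "'a data" "'a data"

datatype expr =
    Var nat
  | NilE
  | PairE expr expr
  | FstE expr
  | SndE expr
  | EqE expr expr
  | IfE expr expr expr
  | LetE expr expr
  | CallE nat "expr list"

type_synonym program = "expr list"

fun data_fst :: "'a data \<Rightarrow> 'a data" where
  "data_fst (PairD x y) = x"
| "data_fst _ = NilD"

fun data_snd :: "'a data \<Rightarrow> 'a data" where
  "data_snd (PairD x y) = y"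
| "data_snd _ = NilD"

fun is_pair :: "'a data \<Rightarrow> bool" where
  "is_pair (PairD x y) = True"
| "is_pair _ = False"

definition enc_bool :: "bool \<Rightarrow> 'a data" where
  "enc_bool b = (if b then PairD NilD NilD else NilD)"

inductive
  run :: "program \<Rightarrow> 'a data list \<Rightarrow> expr \<Rightarrow> 'a data \<Rightarrow> nat \<Rightarrow> bool" and
  runs :: "program \<Rightarrow> 'a data list \<Rightarrow> expr list \<Rightarrow> 'a data list \<Rightarrow> nat \<Rightarrow> bool"
  for prg :: program where
  run_Var: "n < length env \<Longrightarrow> run prg env (Var n) (env ! n) 1"
| run_Nil: "run prg env NilE NilD 1"
| run_Pair: "run prg env e1 x t1 \<Longrightarrow> run prg env e2 y t2
    \<Longrightarrow> run prg env (PairE e1 e2) (PairD x y) (Suc (t1 + t2))"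
| run_Fst: "run prg env e x t \<Longrightarrow> run prg env (FstE e) (data_fst x) (Suc t)"
| run_Snd: "run prg env e x t \<Longrightarrow> run prg env (SndE e) (data_snd x) (Suc t)"
| run_Eq: "run prg env e1 x t1 \<Longrightarrow> run prg env e2 y t2
    \<Longrightarrow> run prg env (EqE e1 e2) (enc_bool (\<not> is_pair x \<and> x = y)) (Suc (t1 + t2))"
| run_If_True: "run prg env e x t1 \<Longrightarrow> is_pair x \<Longrightarrow> run prg env e1 y t2
    \<Longrightarrow> run prg env (IfE e e1 e2) y (Suc (t1 + t2))"
| run_If_False: "run prg env e x t1 \<Longrightarrow> \<not> is_pair x \<Longrightarrow> run prg env e2 y t2
    \<Longrightarrow> run prg env (IfE e e1 e2) y (Suc (t1 + t2))"
| run_Let: "run prg env e1 x t1 \<Longrightarrow> run prg (x # env) e2 y t2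
    \<Longrightarrow> run prg env (LetE e1 e2) y (Suc (t1 + t2))"
| run_Call: "runs prg env es xs t1 \<Longrightarrow> i < length prg \<Longrightarrow> run prg xs (prg ! i) y t2
    \<Longrightarrow> run prg env (CallE i es) y (Suc (t1 + t2))"
| runs_Nil: "runs prg env [] [] 0"
| runs_Cons: "run prg env e x t1 \<Longrightarrow> runs prg env es xs t2
    \<Longrightarrow> runs prg env (e # es) (x # xs) (t1 + t2)"

inductive_cases run_elims:
  "run prg env (Var n) x t"
  "run prg env NilE x t"
  "run prg env (PairE e1 e2) x t"
  "run prg env (FstE e) x t"
  "run prg env (SndE e) x t"
  "run prg env (EqE e1 e2) x t"
  "run prg env (IfE e e1 e2) x t"
  "run prg env (LetE e1 e2) x t"
  "run prg env (CallE i es) x t"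
  "runs prg env [] xs t"
  "runs prg env (e # es) xs t"

lemma run_deterministic:
  "run prg env e x t \<Longrightarrow> run prg env e x' t' \<Longrightarrow> x' = x \<and> t' = t"
  "runs prg env es xs s \<Longrightarrow> runs prg env es xs' s' \<Longrightarrow> xs' = xs \<and> s' = s"
proof (induction arbitrary: x' t' and xs' s' rule: run_runs.inducts)
qed (erule run_elims; (blast | metis | simp))+

definition outputs_within :: "program \<Rightarrow> 'a data list \<Rightarrow> 'a data \<Rightarrow> nat \<Rightarrow> bool" where
  "outputs_within prg args out bound \<longleftrightarrow>
     prg \<noteq> [] \<and> (\<exists>t \<le> bound. run prg args (hd prg) out t)"

section \<open>Encoding of inputs and outputs\<close>

definition enc_list :: "'a data list \<Rightarrow> 'a data" where
  "enc_list xs = foldr PairD xs NilD"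

definition enc_unary :: "nat \<Rightarrow> 'a data" where
  "enc_unary n = enc_list (replicate n NilD)"

fun bits :: "nat \<Rightarrow> bool list" where
  "bits n = (if n = 0 then [] else odd n # bits (n div 2))"

declare bits.simps [simp del]

definition enc_binary :: "nat \<Rightarrow> 'a data" where
  "enc_binary n = enc_list (map enc_bool (bits n))"

text \<open>
  A DAG is presented, as is usual for circuits, by listing its nodes without repetition, children
  before parents; the root is then the last node.  References to children are positions in
  this list.  Writing positions in unary makes the data at most polynomially longer, as
  they are smaller than the number of nodes.
\<close>

definition dag_listing :: "'a form \<Rightarrow> 'a form list \<Rightarrow> bool" where
  "dag_listing f ns \<longleftrightarrow>
     distinct ns \<and> set ns = subforms f \<and>
     (\<forall>i < length ns. children (ns ! i) \<subseteq> set (take i ns))"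

definition position :: "'a form list \<Rightarrow> 'a form \<Rightarrow> nat" where
  "position ns f = (LEAST i. i < length ns \<and> ns ! i = f)"

definition enc_ref :: "'a form list \<Rightarrow> 'a form \<Rightarrow> 'a data" where
  "enc_ref ns f = enc_unary (position ns f)"

definition enc_refs :: "'a form list \<Rightarrow> 'a form fset \<Rightarrow> 'a data" where
  "enc_refs ns S = enc_list (map enc_unary (sorted_list_of_set (position ns ` fset S)))"

fun enc_node :: "'a form list \<Rightarrow> 'a form \<Rightarrow> 'a data" where
  "enc_node ns (Atom a) = PairD (enc_unary 0) (Sym a)"
| "enc_node ns (Neg f) = PairD (enc_unary 1) (enc_ref ns f)"
| "enc_node ns (And S) = PairD (enc_unary 2) (enc_refs ns S)"
| "enc_node ns (Or S) = PairD (enc_unary 3) (enc_refs ns S)"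
| "enc_node ns (Imp f g) = PairD (enc_unary 4) (PairD (enc_ref ns f) (enc_ref ns g))"
| "enc_node ns (Iff f g) = PairD (enc_unary 5) (PairD (enc_ref ns f) (enc_ref ns g))"

definition enc_dag :: "'a form list \<Rightarrow> 'a data" where
  "enc_dag ns = enc_list (map (enc_node ns) ns)"

definition enc_atoms :: "'a list \<Rightarrow> 'a data" where
  "enc_atoms as = enc_list (map Sym as)"

fun enc_literal :: "'a form \<Rightarrow> 'a data" where
  "enc_literal (Atom a) = PairD (enc_bool True) (Sym a)"
| "enc_literal (Neg (Atom a)) = PairD (enc_bool False) (Sym a)"
| "enc_literal _ = NilD"

definition enc_literals :: "'a form list \<Rightarrow> 'a data" where
  "enc_literals ls = enc_list (map enc_literal ls)"

text \<open>
  A set of conjunctions of literals is presented as a list, without repetition, of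
  repetition-free lists of literals.
\<close>

definition presents_conjunctions :: "'a data \<Rightarrow> 'a form set \<Rightarrow> bool" where
  "presents_conjunctions out E \<longleftrightarrow>
     (\<exists>lss. out = enc_list (map enc_literals lss) \<and>
            (\<forall>ls \<in> set lss. distinct ls \<and> (\<forall>l \<in> set ls. is_literal l)) \<and>
            distinct (map (\<lambda>ls. And (fset_of_list ls)) lss) \<and>
            set (map (\<lambda>ls. And (fset_of_list ls)) lss) = E)"

end

theory Submission
  imports Defs
begin

text \<open>
  If \<open>\<psi>\<close> is reduced with respect to \<open>\<alpha>\<close>, every valuation satisfying the abstraction of \<open>\<psi>\<close> agrees
  on \<open>\<alpha>\<close> with some interpretation of the theory.  Hence all four questions become propositional.

  In a decomposable formula, satisfiability under a partial assignment propagates bottom-up: a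
  conjunction is satisfiable iff its children are.  This decides (a) and, assigning the complements
  of the literals of the clause, (b), where tautological clauses have to be treated apart.  For (c),
  the number of models is taken over all of \<open>\<alpha>\<close> at every node, which makes smoothing unnecessary:
  disjunctions add up, and since the children of a conjunction constrain disjoint sets of atoms,
  conjoining multiplies the counts and divides by \<open>2 ^ |\<alpha>|\<close>, a shift in binary.  For (d), the atoms
  are assigned one by one and unsatisfiable branches are cut; each surviving branch leads to an
  output, so there are at most \<open>1 + 2 |\<alpha>| k\<close> calls for \<open>k\<close> outputs, and \<open>|\<alpha>|\<close> itself is bounded
  by the size of \<open>\<psi>\<close> plus \<open>k\<close> unless \<open>k = 0\<close>, when the first test already fails.
\<close>

section \<open>Formulas and their listings\<close>

lemma sat_cong: "(\<And>a. a \<in> atoms f \<Longrightarrow> v a = w a) \<Longrightarrow> sat v f \<longleftrightarrow> sat w f"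
  by (induction f) (simp; blast?)+

lemma root_in_subforms: "f \<in> subforms f"
  by (cases f) auto

lemma subforms_eq_children: "subforms f = insert f (\<Union>(subforms ` children f))"
  by (cases f) auto

lemma children_induct [case_names step]:
  assumes "\<And>f. (\<And>g. g \<in> children f \<Longrightarrow> P g) \<Longrightarrow> P f"
  shows "P f"
  by (induction f) (rule assms; auto)+

lemma atoms_subforms: "g \<in> subforms f \<Longrightarrow> atoms g \<subseteq> atoms f"
  by (induction f) auto

lemma Atom_in_subforms: "a \<in> atoms f \<Longrightarrow> Atom a \<in> subforms f"
  by (induction f) auto

lemma card_atoms_le_dag_size: "card (atoms f) \<le> dag_size f"
  unfolding dag_size_def
  by (rule card_inj_on_le[of Atom]) (auto simp: inj_on_def Atom_in_subforms finite_subforms)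

lemma children_subset_subforms: "children f \<subseteq> subforms f"
  using root_in_subforms subforms_eq_children[of f] by blast

lemma length_children_le_dag_size:
  assumes "distinct gs" "set gs = children f"
  shows "length gs \<le> dag_size f"
proof -
  have "length gs = card (children f)" using assms distinct_card by metis
  also have "\<dots> \<le> dag_size f"
    unfolding dag_size_def by (intro card_mono finite_subforms children_subset_subforms)
  finally show ?thesis .
qed

lemma subforms_parent:
  assumes "g \<in> subforms f" "g \<noteq> f"
  obtains h where "h \<in> subforms f" "g \<in> children h"
proof -
  have "\<exists>h \<in> subforms f. g \<in> children h"
    using assms
  proof (induction f rule: children_induct)
    case (step f)
    then obtain k where k: "k \<in> children f" "g \<in> subforms k"
      using subforms_eq_children[of f] by auto
    then show ?case
      using step.IH[OF k] root_in_subforms[of f] subforms_eq_children[of f] by (cases "g = k") auto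
  qed
  with that show thesis by blast
qed

lemma dag_listing_children:
  assumes "dag_listing f (xs @ g # ys)"
  shows "children g \<subseteq> set xs"
proof -
  have "length xs < length (xs @ g # ys)" by simp
  then have "children ((xs @ g # ys) ! length xs) \<subseteq> set (take (length xs) (xs @ g # ys))"
    using assms unfolding dag_listing_def by blast
  then show ?thesis by simp
qed

lemma dag_listing_last:
  assumes "dag_listing f ns"
  shows "last ns = f" and "ns \<noteq> []"
proof -
  have listing: "distinct ns" "set ns = subforms f" using assms by (auto simp: dag_listing_def)
  show "ns \<noteq> []" using listing(2) root_in_subforms[of f] by auto
  then have "last ns \<in> subforms f" using listing(2) last_in_set by blast
  show "last ns = f"
  proof (rule ccontr)
    assume "last ns \<noteq> f"
    then obtain h where "h \<in> set ns" "last ns \<in> children h"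
      using \<open>last ns \<in> subforms f\<close> listing(2) by (metis subforms_parent)
    then obtain xs ys where ns: "ns = xs @ h # ys" by (auto dest: split_list)
    then have "last ns \<in> set xs"
      using dag_listing_children assms \<open>last ns \<in> children h\<close> by blast
    moreover have "last ns \<in> set (h # ys)" unfolding ns by (simp del: last.simps list.set)
    ultimately show False using listing(1) unfolding ns by auto
  qed
qed

lemma dag_listing_length: "dag_listing f ns \<Longrightarrow> length ns = dag_size f"
  unfolding dag_listing_def dag_size_def using distinct_card by metis

lemma position_append:
  assumes "distinct (xs @ g # ys)"
  shows "position (xs @ g # ys) g = length xs"
  unfolding position_def
proof (rule Least_equality)
  fix i assume "i < length (xs @ g # ys) \<and> (xs @ g # ys) ! i = g"
  with assms show "length xs \<le> i"
    by (metis distinct_append disjoint_iff in_set_conv_nth list.set_intros(1) not_le nth_append)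
qed simp

section \<open>Literals and partial assignments\<close>

definition literal :: "bool \<Rightarrow> 'a \<Rightarrow> 'a form" where
  "literal p a = (if p then Atom a else Neg (Atom a))"

fun complement :: "'a form \<Rightarrow> 'a form" where
  "complement (Neg f) = f"
| "complement f = Neg f"

lemma literal_eq_iff [simp]: "literal p a = literal q b \<longleftrightarrow> p = q \<and> a = b"
  by (simp add: literal_def)

lemma is_literal_iff: "is_literal l \<longleftrightarrow> (\<exists>p a. l = literal p a)"
  by (cases l rule: is_literal.cases) (auto simp: literal_def split: if_splits)

lemma is_literal_literal [simp]: "is_literal (literal p a)"
  unfolding is_literal_iff by blast

lemma sat_literal [simp]: "sat v (literal p a) \<longleftrightarrow> v a = p"
  by (simp add: literal_def)

lemma atoms_literal [simp]: "atoms (literal p a) = {a}"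
  by (simp add: literal_def)

lemma complement_literal [simp]: "complement (literal p a) = literal (\<not> p) a"
  by (simp add: literal_def)

lemma sat_complement [simp]: "sat v (complement f) \<longleftrightarrow> \<not> sat v f"
  by (cases f) auto

lemma is_literal_complement: "is_literal l \<Longrightarrow> is_literal (complement l)"
  by (auto simp: is_literal_iff)

definition partial_assignment :: "'a form set \<Rightarrow> bool" where
  "partial_assignment L \<longleftrightarrow> (\<forall>l \<in> L. is_literal l) \<and> (\<forall>l \<in> L. complement l \<notin> L)"

definition satisfiable_with :: "'a form set \<Rightarrow> 'a form \<Rightarrow> bool" where
  "satisfiable_with L f \<longleftrightarrow> (\<exists>v. (\<forall>l \<in> L. sat v l) \<and> sat v f)"

lemma partial_assignment_empty: "partial_assignment {}"
  by (simp add: partial_assignment_def)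

lemma partial_assignment_insert:
  assumes "partial_assignment L" "a \<notin> \<Union>(atoms ` L)"
  shows "partial_assignment (insert (literal p a) L)"
  using assms unfolding partial_assignment_def is_literal_iff by fastforce

lemma partial_assignment_sat:
  assumes "partial_assignment L" "l \<in> L"
  shows "sat (\<lambda>a. literal True a \<in> L) l"
proof -
  obtain p a where "l = literal p a"
    using assms unfolding partial_assignment_def is_literal_iff by blast
  with assms show ?thesis by (cases p) (auto simp: partial_assignment_def)
qed

lemma not_satisfiable_with_complementary:
  "l \<in> L \<Longrightarrow> complement l \<in> L \<Longrightarrow> \<not> satisfiable_with L f"
  unfolding satisfiable_with_def using sat_complement by blast

lemma satisfiable_with_literal:
  assumes "partial_assignment L"
  shows "satisfiable_with L (literal p a) \<longleftrightarrow> literal (\<not> p) a \<notin> L"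
proof
  show "literal (\<not> p) a \<notin> L" if "satisfiable_with L (literal p a)"
    using that by (auto simp: satisfiable_with_def)
next
  assume not_in: "literal (\<not> p) a \<notin> L"
  let ?v = "(\<lambda>b. literal True b \<in> L)(a := p)"
  have "sat ?v l" if "l \<in> L" for l
  proof -
    obtain q b where "l = literal q b"
      using assms \<open>l \<in> L\<close> unfolding partial_assignment_def is_literal_iff by blast
    with not_in that partial_assignment_sat[OF assms that] show ?thesis
      by (cases "b = a"; cases "q = p") auto
  qed
  then show "satisfiable_with L (literal p a)"
    unfolding satisfiable_with_def by (intro exI[of _ ?v]) simp
qed

lemma satisfiable_with_And_empty: "partial_assignment L \<Longrightarrow> satisfiable_with L (And {||})"
  unfolding satisfiable_with_def using partial_assignment_sat by fastforce

lemma satisfiable_with_Or_empty: "\<not> satisfiable_with L (Or {||})"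
  by (simp add: satisfiable_with_def)

lemma satisfiable_with_Or_finsert:
  "satisfiable_with L (Or (finsert g F)) \<longleftrightarrow> satisfiable_with L (Or F) \<or> satisfiable_with L g"
  by (auto simp: satisfiable_with_def)

lemma satisfiable_with_And_finsert:
  assumes "\<forall>l \<in> L. is_literal l" "atoms (And F) \<inter> atoms g = {}"
  shows "satisfiable_with L (And (finsert g F)) \<longleftrightarrow>
    satisfiable_with L (And F) \<and> satisfiable_with L g"
proof
  assume "satisfiable_with L (And (finsert g F))"
  then show "satisfiable_with L (And F) \<and> satisfiable_with L g"
    by (auto simp: satisfiable_with_def)
next
  assume "satisfiable_with L (And F) \<and> satisfiable_with L g"
  then obtain v w where v: "\<forall>l \<in> L. sat v l" "sat v (And F)" and w: "\<forall>l \<in> L. sat w l" "sat w g"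
    by (auto simp: satisfiable_with_def)
  let ?u = "override_on v w (atoms g)"
  have "sat ?u (And F) \<longleftrightarrow> sat v (And F)"
    using assms(2) by (intro sat_cong) (auto simp: override_on_def)
  moreover have "sat ?u g \<longleftrightarrow> sat w g" by (intro sat_cong) simp
  moreover have "sat ?u l" if "l \<in> L" for l
  proof -
    obtain p a where "l = literal p a" using assms(1) \<open>l \<in> L\<close> unfolding is_literal_iff by blast
    then show ?thesis using v(1) w(1) that by (cases "a \<in> atoms g") auto
  qed
  ultimately show "satisfiable_with L (And (finsert g F))"
    using v w unfolding satisfiable_with_def by auto
qed

section \<open>Counting models\<close>

definition models :: "'a set \<Rightarrow> 'a form \<Rightarrow> 'a set set" where
  "models \<alpha> f = {X. X \<subseteq> \<alpha> \<and> sat (\<lambda>a. a \<in> X) f}"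

lemma finite_models [simp]: "finite \<alpha> \<Longrightarrow> finite (models \<alpha> f)"
  by (rule finite_subset[of _ "Pow \<alpha>"]) (auto simp: models_def)

lemma card_models_le: "finite \<alpha> \<Longrightarrow> card (models \<alpha> f) \<le> 2 ^ card \<alpha>"
  by (subst card_Pow[symmetric], assumption) (intro card_mono; auto simp: models_def)

lemma card_models_And_empty: "finite \<alpha> \<Longrightarrow> card (models \<alpha> (And {||})) = 2 ^ card \<alpha>"
  by (simp add: models_def card_Pow flip: Pow_def)

lemma card_models_Or_empty: "card (models \<alpha> (Or {||})) = 0"
  by (simp add: models_def)

lemma card_models_Or_finsert:
  assumes "finite \<alpha>" "\<And>h. h |\<in>| F \<Longrightarrow> \<not> (\<exists>v. sat v g \<and> sat v h)"
  shows "card (models \<alpha> (Or (finsert g F))) = card (models \<alpha> (Or F)) + card (models \<alpha> g)"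
proof -
  have "models \<alpha> (Or (finsert g F)) = models \<alpha> (Or F) \<union> models \<alpha> g"
    by (auto simp: models_def)
  moreover have "models \<alpha> (Or F) \<inter> models \<alpha> g = {}"
    using assms(2) by (auto simp: models_def)
  ultimately show ?thesis using assms(1) by (simp add: card_Un_disjoint)
qed

lemma card_models_Un:
  assumes "finite A" "finite B" "A \<inter> B = {}" "atoms f \<inter> B = {}" "atoms g \<inter> A = {}"
    and h: "\<And>v. sat v h \<longleftrightarrow> sat v f \<and> sat v g"
  shows "card (models (A \<union> B) h) = card (models A f) * card (models B g)"
proof -
  have f: "sat (\<lambda>a. a \<in> X \<union> Y) f \<longleftrightarrow> sat (\<lambda>a. a \<in> X) f" if "Y \<subseteq> B" for X Y
    using that assms(4) by (intro sat_cong) auto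
  have g: "sat (\<lambda>a. a \<in> X \<union> Y) g \<longleftrightarrow> sat (\<lambda>a. a \<in> Y) g" if "X \<subseteq> A" for X Y
    using that assms(5) by (intro sat_cong) auto
  have "bij_betw (\<lambda>(X, Y). X \<union> Y) (models A f \<times> models B g) (models (A \<union> B) h)"
  proof (rule bij_betw_byWitness[where f' = "\<lambda>Z. (Z \<inter> A, Z \<inter> B)"])
    show "(\<lambda>(X, Y). X \<union> Y) ` (models A f \<times> models B g) \<subseteq> models (A \<union> B) h"
      using f g by (auto simp: models_def h)
    show "(\<lambda>Z. (Z \<inter> A, Z \<inter> B)) ` models (A \<union> B) h \<subseteq> models A f \<times> models B g"
    proof (rule image_subsetI)
      fix Z assume "Z \<in> models (A \<union> B) h"
      then have "Z \<inter> A \<union> Z \<inter> B = Z" "sat (\<lambda>a. a \<in> Z) f" "sat (\<lambda>a. a \<in> Z) g"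
        by (auto simp: models_def h)
      then show "(Z \<inter> A, Z \<inter> B) \<in> models A f \<times> models B g"
        using f[of "Z \<inter> B" "Z \<inter> A"] g[of "Z \<inter> A" "Z \<inter> B"] by (auto simp: models_def)
    qed
  qed (use assms(3) in \<open>auto simp: models_def\<close>)
  from bij_betw_same_card[OF this] show ?thesis by (simp add: card_cartesian_product)
qed

lemma card_models_free_atoms:
  assumes "finite A" "finite B" "A \<inter> B = {}" "atoms f \<inter> B = {}"
  shows "card (models (A \<union> B) f) = card (models A f) * 2 ^ card B"
  using card_models_Un[OF assms, of "And {||}" f] assms(2) by (simp add: card_models_And_empty)

lemma card_models_And_finsert:
  assumes "finite \<alpha>" "atoms (And F) \<inter> atoms g = {}"
  shows "card (models \<alpha> (And (finsert g F))) =
    card (models \<alpha> (And F)) * card (models \<alpha> g) div 2 ^ card \<alpha>"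
proof -
  define A B where "A = \<alpha> - atoms g" and "B = \<alpha> \<inter> atoms g"
  have fin: "finite A" "finite B" and disj: "A \<inter> B = {}" "B \<inter> A = {}"
    and \<alpha>: "\<alpha> = A \<union> B" "\<alpha> = B \<union> A"
    using assms(1) by (auto simp: A_def B_def)
  have F: "atoms (And F) \<inter> B = {}" and g: "atoms g \<inter> A = {}"
    using assms(2) by (auto simp: A_def B_def)
  have "card (models \<alpha> (And (finsert g F))) = card (models A (And F)) * card (models B g)"
    unfolding \<alpha>(1) using fin disj(1) F g by (intro card_models_Un) auto
  moreover have "card (models \<alpha> (And F)) = card (models A (And F)) * 2 ^ card B"
    unfolding \<alpha>(1) using fin disj(1) F by (rule card_models_free_atoms)
  moreover have "card (models \<alpha> g) = card (models B g) * 2 ^ card A"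
    unfolding \<alpha>(2) using fin(2,1) disj(2) g by (rule card_models_free_atoms)
  moreover have "card \<alpha> = card A + card B"
    unfolding \<alpha>(1) using fin disj(1) by (rule card_Un_disjoint)
  ultimately show ?thesis by (simp add: power_add)
qed

lemma card_models_literal:
  assumes "finite \<alpha>" "a \<in> \<alpha>"
  shows "card (models \<alpha> (literal p a)) = 2 ^ (card \<alpha> - 1)"
proof -
  have "models {a} (literal p a) = {if p then {a} else {}}" by (auto simp: models_def)
  then have "card (models ({a} \<union> (\<alpha> - {a})) (literal p a)) = 2 ^ card (\<alpha> - {a})"
    using assms(1) by (subst card_models_free_atoms) auto
  with assms show ?thesis by (simp add: insert_absorb)
qed

lemma card_free_atoms_le_models:
  assumes "finite \<alpha>" "sat v f" "atoms f \<subseteq> \<alpha>"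
  shows "card (\<alpha> - atoms f) \<le> card (models \<alpha> f)"
proof -
  have fin: "finite (atoms f)" using assms(1,3) by (rule rev_finite_subset)
  have "sat (\<lambda>a. a \<in> {a \<in> atoms f. v a}) f \<longleftrightarrow> sat v f" by (rule sat_cong) simp
  then have "{a \<in> atoms f. v a} \<in> models (atoms f) f" using assms(2) by (auto simp: models_def)
  then have "1 \<le> card (models (atoms f) f)" using fin by (simp add: Suc_le_eq card_gt_0_iff) blast
  have "card (\<alpha> - atoms f) \<le> 2 ^ card (\<alpha> - atoms f)" by (simp add: less_imp_le)
  also have "\<dots> \<le> card (models (atoms f) f) * 2 ^ card (\<alpha> - atoms f)"
    using \<open>1 \<le> card (models (atoms f) f)\<close> by simp
  also have "\<dots> = card (models (atoms f \<union> (\<alpha> - atoms f)) f)"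
    using assms(1) fin by (intro card_models_free_atoms[symmetric]) auto
  also have "atoms f \<union> (\<alpha> - atoms f) = \<alpha>" using assms(3) by blast
  finally show ?thesis .
qed

lemma length_le_dag_size_plus_free_atoms:
  assumes "distinct as" "atoms f \<subseteq> set as"
  shows "length as \<le> dag_size f + card (set as - atoms f)"
proof -
  have "card (set as - atoms f) = card (set as) - card (atoms f)"
    using assms(2) by (intro card_Diff_subset) (auto intro: finite_subset)
  then show ?thesis
    using card_atoms_le_dag_size[of f] distinct_card[OF assms(1)] by linarith
qed

section \<open>Nodes of a d-DNNF formula\<close>

definition junction :: "bool \<Rightarrow> 'a form fset \<Rightarrow> 'a form" where
  "junction d S = (if d then Or S else And S)"

lemma children_junction [simp]: "children (junction d S) = fset S"
  by (simp add: junction_def)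

lemma nnf_cases [consumes 2, case_names literal junction]:
  assumes "nnf f" "g \<in> subforms f"
  obtains p a where "g = literal p a" | d S where "g = junction d S"
  using assms unfolding nnf_def by (fastforce simp: is_literal_iff junction_def)

lemma atoms_And_disjoint:
  assumes "decomposable f" "And S \<in> subforms f" "finsert g F |\<subseteq>| S" "g |\<notin>| F"
  shows "atoms (And F) \<inter> atoms g = {}"
proof -
  have "atoms h \<inter> atoms g = {}" if "h |\<in>| F" for h
  proof -
    have "h |\<in>| S" "g |\<in>| S" "h \<noteq> g" using assms(3,4) that by auto
    then show ?thesis using assms(1,2) unfolding decomposable_def by blast
  qed
  then show ?thesis by auto
qed

lemma Or_inconsistent:
  assumes "deterministic f" "Or S \<in> subforms f" "finsert g F |\<subseteq>| S" "g |\<notin>| F" "h |\<in>| F"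
  shows "\<not> (\<exists>v. sat v g \<and> sat v h)"
proof -
  have "g |\<in>| S" "h |\<in>| S" "g \<noteq> h" using assms(3-5) by auto
  with assms(1,2) show ?thesis unfolding deterministic_def by blast
qed

lemma satisfiable_with_junction_finsert:
  assumes "decomposable f" "junction d S \<in> subforms f" "finsert g F |\<subseteq>| S" "g |\<notin>| F"
    and "\<forall>l \<in> L. is_literal l"
  shows "satisfiable_with L (junction d (finsert g F)) \<longleftrightarrow>
    (if d then satisfiable_with L (junction d F) \<or> satisfiable_with L g
     else satisfiable_with L (junction d F) \<and> satisfiable_with L g)"
proof (cases d)
  case True
  then show ?thesis by (simp add: junction_def satisfiable_with_Or_finsert)
next
  case False
  then have "atoms (And F) \<inter> atoms g = {}"
    using assms by (intro atoms_And_disjoint[of f S]) (simp_all add: junction_def)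
  with False assms(5) show ?thesis
    by (simp only: junction_def if_False satisfiable_with_And_finsert)
qed

lemma card_models_junction_finsert:
  assumes "decomposable f" "deterministic f" "junction d S \<in> subforms f"
    and "finsert g F |\<subseteq>| S" "g |\<notin>| F" "finite \<alpha>"
  shows "card (models \<alpha> (junction d (finsert g F))) =
    (if d then card (models \<alpha> (junction d F)) + card (models \<alpha> g)
     else card (models \<alpha> (junction d F)) * card (models \<alpha> g) div 2 ^ card \<alpha>)"
proof (cases d)
  case True
  then have "\<And>h. h |\<in>| F \<Longrightarrow> \<not> (\<exists>v. sat v g \<and> sat v h)"
    using Or_inconsistent[OF assms(2) _ assms(4,5)] assms(3) by (simp add: junction_def)
  with assms(6) have "card (models \<alpha> (Or (finsert g F))) =
      card (models \<alpha> (Or F)) + card (models \<alpha> g)"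
    by (rule card_models_Or_finsert)
  with True show ?thesis by (simp only: junction_def if_True)
next
  case False
  then have "atoms (And F) \<inter> atoms g = {}"
    using assms by (intro atoms_And_disjoint[of f S]) (simp_all add: junction_def)
  with False assms(6) show ?thesis
    by (simp only: junction_def if_False card_models_And_finsert)
qed

section \<open>Formulas reduced with respect to a theory\<close>

definition cube :: "'a set \<Rightarrow> ('a \<Rightarrow> bool) \<Rightarrow> 'a form" where
  "cube \<alpha> v = And (Abs_fset ((\<lambda>a. literal (v a) a) ` \<alpha>))"

abbreviation literals_of :: "('a \<Rightarrow> bool) \<Rightarrow> 'a list \<Rightarrow> 'a form list" where
  "literals_of v as \<equiv> map (\<lambda>a. literal (v a) a) as"

lemma cube_set: "cube (set as) v = And (fset_of_list (literals_of v as))"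
  unfolding cube_def by (metis fset_inverse fset_of_list.rep_eq image_set)

lemma fset_Abs_fset_literals:
  "finite \<alpha> \<Longrightarrow> fset (Abs_fset ((\<lambda>a. literal (v a) a) ` \<alpha>)) = (\<lambda>a. literal (v a) a) ` \<alpha>"
  by (rule Abs_fset_inverse) simp

lemma sat_cube: "finite \<alpha> \<Longrightarrow> sat w (cube \<alpha> v) \<longleftrightarrow> (\<forall>a \<in> \<alpha>. w a = v a)"
  by (simp add: cube_def fset_Abs_fset_literals)

lemma cube_eq_iff:
  assumes "finite \<alpha>"
  shows "cube \<alpha> v = cube \<alpha> w \<longleftrightarrow> (\<forall>a \<in> \<alpha>. v a = w a)"
proof
  show "\<forall>a \<in> \<alpha>. v a = w a" if "cube \<alpha> v = cube \<alpha> w"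
    using that sat_cube[OF assms, of v v] sat_cube[OF assms, of v w] by simp
  show "cube \<alpha> v = cube \<alpha> w" if "\<forall>a \<in> \<alpha>. v a = w a"
    using that by (simp add: cube_def cong: image_cong)
qed

lemma total_assignment_cube:
  assumes "finite \<alpha>"
  shows "total_assignment \<alpha> (cube \<alpha> v)"
proof -
  let ?S = "Abs_fset ((\<lambda>a. literal (v a) a) ` \<alpha>)"
  have literals: "literal p a |\<in>| ?S \<longleftrightarrow> a \<in> \<alpha> \<and> p = v a" for p a
    by (auto simp: fset_Abs_fset_literals[OF assms])
  have "(Atom a |\<in>| ?S) \<noteq> (Neg (Atom a) |\<in>| ?S)" if "a \<in> \<alpha>" for a
    using that literals[of True a] literals[of False a] by (auto simp: literal_def)
  moreover have "\<forall>l |\<in>| ?S. is_literal l \<and> atoms l \<subseteq> \<alpha>"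
    by (simp add: fset_Abs_fset_literals[OF assms])
  ultimately show ?thesis unfolding total_assignment_def cube_def by blast
qed

lemma total_assignmentE:
  assumes "total_assignment \<alpha> \<eta>" "finite \<alpha>"
  obtains v where "\<eta> = cube \<alpha> v"
proof -
  obtain S where S: "\<eta> = And S" "\<forall>l |\<in>| S. is_literal l \<and> atoms l \<subseteq> \<alpha>"
    "\<forall>a \<in> \<alpha>. (Atom a |\<in>| S) \<noteq> (Neg (Atom a) |\<in>| S)"
    using assms(1) unfolding total_assignment_def by (elim exE conjE)
  define v where "v a \<longleftrightarrow> Atom a |\<in>| S" for a
  have literal_in_S: "literal p a |\<in>| S \<longleftrightarrow> a \<in> \<alpha> \<and> p = v a" for p a
    using bspec[OF S(2), of "literal p a"] bspec[OF S(3), of a]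
    by (cases p) (auto simp: literal_def v_def)
  have "fset S = (\<lambda>a. literal (v a) a) ` \<alpha>"
  proof (intro equalityI subsetI)
    fix l assume l: "l \<in> fset S"
    then have "is_literal l" using S(2) by blast
    then obtain p a where "l = literal p a" unfolding is_literal_iff by blast
    with l show "l \<in> (\<lambda>a. literal (v a) a) ` \<alpha>" using literal_in_S[of p a] by simp
  next
    fix l assume "l \<in> (\<lambda>a. literal (v a) a) ` \<alpha>"
    then obtain a where "l = literal (v a) a" "a \<in> \<alpha>" by blast
    then show "l \<in> fset S" using literal_in_S[of "v a" a] by simp
  qed
  then have "S = Abs_fset ((\<lambda>a. literal (v a) a) ` \<alpha>)" by (metis fset_inverse)
  with that S(1) show thesis by (simp only: cube_def)
qed

lemma cube_entails_iff:
  assumes "finite \<alpha>" "atoms f \<subseteq> \<alpha>"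
  shows "cube \<alpha> v \<Turnstile>\<^sub>p f \<longleftrightarrow> sat v f"
proof
  show "sat v f" if "cube \<alpha> v \<Turnstile>\<^sub>p f"
    using that unfolding prop_entails_def sat_cube[OF assms(1)] by blast
  show "cube \<alpha> v \<Turnstile>\<^sub>p f" if "sat v f"
    unfolding prop_entails_def sat_cube[OF assms(1)]
  proof (intro allI impI)
    fix w assume "\<forall>a \<in> \<alpha>. w a = v a"
    then have "sat w f \<longleftrightarrow> sat v f" using assms(2) by (intro sat_cong) auto
    with that show "sat w f" by simp
  qed
qed

lemma bij_betw_models_cubes:
  assumes "finite \<alpha>" "atoms f \<subseteq> \<alpha>"
  shows "bij_betw (\<lambda>X. cube \<alpha> (\<lambda>a. a \<in> X)) (models \<alpha> f) (cube \<alpha> ` {v. sat v f})"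
  unfolding bij_betw_def
proof (intro conjI equalityI subsetI)
  show "inj_on (\<lambda>X. cube \<alpha> (\<lambda>a. a \<in> X)) (models \<alpha> f)"
    unfolding inj_on_def cube_eq_iff[OF assms(1)] by (auto simp: models_def)
next
  fix \<eta> assume "\<eta> \<in> cube \<alpha> ` {v. sat v f}"
  then obtain v where v: "\<eta> = cube \<alpha> v" "sat v f" by blast
  have "sat (\<lambda>a. a \<in> {a \<in> \<alpha>. v a}) f \<longleftrightarrow> sat v f" using assms(2) by (intro sat_cong) auto
  then have "{a \<in> \<alpha>. v a} \<in> models \<alpha> f" using v(2) by (auto simp: models_def)
  moreover have "\<eta> = cube \<alpha> (\<lambda>a. a \<in> {a \<in> \<alpha>. v a})"
    unfolding v(1) cube_eq_iff[OF assms(1)] by simp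
  ultimately show "\<eta> \<in> (\<lambda>X. cube \<alpha> (\<lambda>a. a \<in> X)) ` models \<alpha> f" by (rule rev_image_eqI)
qed (auto simp: models_def)

locale T_reduced_form =
  fixes T :: "('m, 't) smt_theory" and \<alpha> :: "('t, 'b) atom set" and \<psi> :: "('t, 'b) atom form"
  assumes reduced: "T_reduced T \<alpha> \<psi>" and finite_atoms: "finite \<alpha>" and atoms_subset: "atoms \<psi> \<subseteq> \<alpha>"
begin

lemma H_assignments_eq: "H_assignments T \<alpha> \<psi> = cube \<alpha> ` {v. sat v \<psi>}"
proof (intro equalityI subsetI)
  fix \<eta> assume "\<eta> \<in> H_assignments T \<alpha> \<psi>"
  then have "total_assignment \<alpha> \<eta>" "\<eta> \<Turnstile>\<^sub>p \<psi>" by (simp_all add: H_assignments_def)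
  moreover from this(1) finite_atoms obtain v where "\<eta> = cube \<alpha> v" by (rule total_assignmentE)
  ultimately show "\<eta> \<in> cube \<alpha> ` {v. sat v \<psi>}"
    using cube_entails_iff[OF finite_atoms atoms_subset] by blast
next
  fix \<eta> assume "\<eta> \<in> cube \<alpha> ` {v. sat v \<psi>}"
  then have "total_assignment \<alpha> \<eta>" "\<eta> \<Turnstile>\<^sub>p \<psi>"
    using total_assignment_cube finite_atoms cube_entails_iff[OF finite_atoms atoms_subset] by auto
  then show "\<eta> \<in> H_assignments T \<alpha> \<psi>"
    using reduced unfolding T_reduced_def P_assignments_def H_assignments_def by blast
qed

lemma card_H_assignments: "card (H_assignments T \<alpha> \<psi>) = card (models \<alpha> \<psi>)"
  unfolding H_assignments_eq
  using bij_betw_models_cubes[OF finite_atoms atoms_subset] by (rule bij_betw_same_card[symmetric])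

lemma model_realized:
  assumes "sat v \<psi>"
  obtains M b where "M \<in> interps T" "\<And>f. atoms f \<subseteq> \<alpha> \<Longrightarrow> sat (truth T M b) f \<longleftrightarrow> sat v f"
proof -
  have "T_sat T (cube \<alpha> v)" using assms H_assignments_eq by (auto simp: H_assignments_def)
  then obtain M b where M: "M \<in> interps T" "\<forall>a \<in> \<alpha>. truth T M b a = v a"
    unfolding T_sat_def sat_cube[OF finite_atoms] by blast
  show thesis
  proof
    show "sat (truth T M b) f \<longleftrightarrow> sat v f" if "atoms f \<subseteq> \<alpha>" for f
      using that M(2) by (intro sat_cong) blast
  qed (rule M(1))
qed

lemma T_sat_iff: "T_sat T \<psi> \<longleftrightarrow> satisfiable_with {} \<psi>"
proof
  show "satisfiable_with {} \<psi>" if "T_sat T \<psi>"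
    using that by (auto simp: T_sat_def satisfiable_with_def)
next
  assume "satisfiable_with {} \<psi>"
  then obtain v where "sat v \<psi>" by (auto simp: satisfiable_with_def)
  moreover from this obtain M b
    where "M \<in> interps T" "\<And>f. atoms f \<subseteq> \<alpha> \<Longrightarrow> sat (truth T M b) f \<longleftrightarrow> sat v f"
    by (rule model_realized) blast
  ultimately show "T_sat T \<psi>" using atoms_subset unfolding T_sat_def by blast
qed

lemma T_entails_clause_iff:
  assumes "\<And>l. l \<in> set ls \<Longrightarrow> atoms l \<subseteq> \<alpha>"
  shows "T_entails T \<psi> (Or (fset_of_list ls)) \<longleftrightarrow> \<not> satisfiable_with (complement ` set ls) \<psi>"
proof
  assume entails: "T_entails T \<psi> (Or (fset_of_list ls))"
  show "\<not> satisfiable_with (complement ` set ls) \<psi>"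
  proof
    assume "satisfiable_with (complement ` set ls) \<psi>"
    then obtain v where v: "sat v \<psi>" "\<And>l. l \<in> set ls \<Longrightarrow> \<not> sat v l"
      by (auto simp: satisfiable_with_def)
    obtain M b where M: "M \<in> interps T" "\<And>f. atoms f \<subseteq> \<alpha> \<Longrightarrow> sat (truth T M b) f \<longleftrightarrow> sat v f"
      using v(1) by (rule model_realized) blast
    then have "sat (truth T M b) (Or (fset_of_list ls))"
      using entails v(1) atoms_subset unfolding T_entails_def by blast
    then obtain l where "l \<in> set ls" "sat (truth T M b) l" by (auto simp: fset_of_list.rep_eq)
    with M(2) assms v(2) show False by blast
  qed
next
  assume "\<not> satisfiable_with (complement ` set ls) \<psi>"
  then show "T_entails T \<psi> (Or (fset_of_list ls))"
    unfolding T_entails_def satisfiable_with_def by (auto simp: fset_of_list.rep_eq)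
qed

end

section \<open>Enumerating models\<close>

primrec extensions :: "'a form \<Rightarrow> 'a list \<Rightarrow> 'a form list \<Rightarrow> 'a form list list" where
  "extensions f [] ls = (if satisfiable_with (set ls) f then [ls] else [])"
| "extensions f (a # as) ls = (if satisfiable_with (set ls) f
     then extensions f as (literal True a # ls) @ extensions f as (literal False a # ls) else [])"

primrec extension_calls :: "'a form \<Rightarrow> 'a list \<Rightarrow> 'a form list \<Rightarrow> nat" where
  "extension_calls f [] ls = 1"
| "extension_calls f (a # as) ls = (if satisfiable_with (set ls) f
     then 1 + extension_calls f as (literal True a # ls) +
       extension_calls f as (literal False a # ls)
     else 1)"

lemma set_extensions:
  "set (extensions f as ls) =
     (\<lambda>v. literals_of v (rev as) @ ls) ` {v. (\<forall>l \<in> set ls. sat v l) \<and> sat v f}"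
proof (induction as arbitrary: ls)
  case Nil
  show ?case by (auto simp: satisfiable_with_def)
next
  case (Cons a as)
  let ?V = "\<lambda>ls. {v. (\<forall>l \<in> set ls. sat v l) \<and> sat v f}"
  show ?case
  proof (cases "satisfiable_with (set ls) f")
    case True
    have "(\<lambda>v. literals_of v (rev as) @ literal p a # ls) ` ?V (literal p a # ls) =
        (\<lambda>v. literals_of v (rev (a # as)) @ ls) ` ?V (literal p a # ls)" for p
      by (rule image_cong) auto
    moreover have "?V ls = ?V (literal True a # ls) \<union> ?V (literal False a # ls)" by auto
    ultimately show ?thesis
      using True Cons.IH by (simp only: extensions.simps if_True set_append image_Un)
  next
    case False
    then have "?V ls = {}" by (auto simp: satisfiable_with_def)
    with False show ?thesis by simp
  qed
qed

lemma distinct_extensions: "distinct (extensions f as ls)"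
proof (induction as arbitrary: ls)
  case (Cons a as)
  have "drop (length as) x = ks" if "x \<in> set (extensions f as ks)" for x ks
    using that by (auto simp: set_extensions)
  then have "set (extensions f as (literal True a # ls)) \<inter>
      set (extensions f as (literal False a # ls)) = {}"
    by (metis disjoint_iff list.inject literal_eq_iff)
  then show ?case using Cons.IH by simp
qed simp

lemma extensions_nonempty: "satisfiable_with (set ls) f \<Longrightarrow> extensions f as ls \<noteq> []"
  using set_extensions[of f as ls] unfolding satisfiable_with_def by fastforce

text \<open>A call that is not cut off lies on the path to an output and makes two further calls.\<close>

lemma extension_calls_le:
  "extension_calls f as ls \<le> 1 + 2 * length as * length (extensions f as ls)"
proof (induction as arbitrary: ls)
  case (Cons a as)
  show ?case
  proof (cases "satisfiable_with (set ls) f")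
    case True
    define k where "k = length (extensions f (a # as) ls)"
    have "k \<ge> 1"
      using extensions_nonempty[OF True, of "a # as"] unfolding k_def by (simp add: Suc_le_eq)
    have "extension_calls f (a # as) ls \<le> 3 + 2 * length as * k"
      using Cons.IH[of "literal True a # ls"] Cons.IH[of "literal False a # ls"] True
      by (simp add: k_def algebra_simps)
    also have "\<dots> \<le> 1 + 2 * length (a # as) * k" using \<open>k \<ge> 1\<close> by (simp add: algebra_simps)
    finally show ?thesis unfolding k_def .
  qed simp
qed simp

lemma And_literals_of_rev: "And (fset_of_list (literals_of v (rev as))) = cube (set as) v"
  using cube_set[of "rev as" v] by simp

lemma
  shows image_extensions_Nil:
      "(\<lambda>ls. And (fset_of_list ls)) ` set (extensions f as []) = cube (set as) ` {v. sat v f}"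
    and inj_on_extensions_Nil: "inj_on (\<lambda>ls. And (fset_of_list ls)) (set (extensions f as []))"
proof -
  have set: "set (extensions f as []) = (\<lambda>v. literals_of v (rev as)) ` {v. sat v f}"
    by (simp add: set_extensions)
  show "(\<lambda>ls. And (fset_of_list ls)) ` set (extensions f as []) = cube (set as) ` {v. sat v f}"
    by (simp only: set image_image And_literals_of_rev)
  show "inj_on (\<lambda>ls. And (fset_of_list ls)) (set (extensions f as []))"
  proof (rule inj_onI)
    fix ks ls
    assume "ks \<in> set (extensions f as [])" "ls \<in> set (extensions f as [])"
      and eq: "And (fset_of_list ks) = And (fset_of_list ls)"
    then obtain v w where "ks = literals_of v (rev as)" "ls = literals_of w (rev as)"
      unfolding set by blast
    with eq have "cube (set as) v = cube (set as) w" by (simp only: And_literals_of_rev)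
    with \<open>ks = _\<close> \<open>ls = _\<close> show "ks = ls" by (simp add: cube_eq_iff)
  qed
qed

lemma length_extensions_Nil: "length (extensions f as []) = card (cube (set as) ` {v. sat v f})"
  using card_image[OF inj_on_extensions_Nil, of f as]
    distinct_card[OF distinct_extensions, of f as "[]"]
  unfolding image_extensions_Nil by simp

lemma presents_conjunctions_extensions:
  assumes "distinct as"
  shows "presents_conjunctions (enc_list (map enc_literals (extensions f as [])))
    (cube (set as) ` {v. sat v f})"
  unfolding presents_conjunctions_def
proof (intro exI[of _ "extensions f as []"] conjI ballI)
  fix ls assume "ls \<in> set (extensions f as [])"
  then obtain v where ls: "ls = literals_of v (rev as)" by (auto simp: set_extensions)
  show "distinct ls" using assms by (simp add: ls distinct_map inj_on_def)
  show "is_literal l" if "l \<in> set ls" for l using that by (auto simp: ls)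
next
  show "distinct (map (\<lambda>ls. And (fset_of_list ls)) (extensions f as []))"
    by (simp add: distinct_map distinct_extensions inj_on_extensions_Nil)
  show "set (map (\<lambda>ls. And (fset_of_list ls)) (extensions f as [])) = cube (set as) ` {v. sat v f}"
    by (simp only: set_map image_extensions_Nil)
qed simp

section \<open>Weakest preconditions\<close>

definition wp :: "program \<Rightarrow> 'a data list \<Rightarrow> expr \<Rightarrow> ('a data \<Rightarrow> nat \<Rightarrow> bool) \<Rightarrow> bool" where
  "wp prg env e Q \<longleftrightarrow> (\<exists>x t. run prg env e x t \<and> Q x t)"

definition wps :: "program \<Rightarrow> 'a data list \<Rightarrow> expr list \<Rightarrow> ('a data list \<Rightarrow> nat \<Rightarrow> bool) \<Rightarrow> bool" where
  "wps prg env es Q \<longleftrightarrow> (\<exists>xs t. runs prg env es xs t \<and> Q xs t)"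

lemma wp_Var: "wp prg env (Var n) Q \<longleftrightarrow> n < length env \<and> Q (env ! n) 1"
  unfolding wp_def by (auto intro: run_Var[unfolded One_nat_def] elim!: run_elims)

lemma wp_Nil: "wp prg env NilE Q \<longleftrightarrow> Q NilD 1"
  unfolding wp_def by (auto intro: run_Nil[unfolded One_nat_def] elim!: run_elims)

lemma wp_Pair:
  "wp prg env (PairE e1 e2) Q \<longleftrightarrow>
     wp prg env e1 (\<lambda>x t1. wp prg env e2 (\<lambda>y t2. Q (PairD x y) (Suc (t1 + t2))))"
  unfolding wp_def by (blast intro: run_Pair elim: run_elims)

lemma wp_Fst: "wp prg env (FstE e) Q \<longleftrightarrow> wp prg env e (\<lambda>x t. Q (data_fst x) (Suc t))"
  unfolding wp_def by (blast intro: run_Fst elim: run_elims)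

lemma wp_Snd: "wp prg env (SndE e) Q \<longleftrightarrow> wp prg env e (\<lambda>x t. Q (data_snd x) (Suc t))"
  unfolding wp_def by (blast intro: run_Snd elim: run_elims)

lemma wp_Eq:
  "wp prg env (EqE e1 e2) Q \<longleftrightarrow>
     wp prg env e1 (\<lambda>x t1. wp prg env e2 (\<lambda>y t2.
       Q (enc_bool (\<not> is_pair x \<and> x = y)) (Suc (t1 + t2))))"
  unfolding wp_def by (blast intro: run_Eq elim: run_elims)

lemma run_If_iff:
  "run prg env (IfE e e1 e2) y t \<longleftrightarrow>
     (\<exists>x t1 t2. run prg env e x t1 \<and> run prg env (if is_pair x then e1 else e2) y t2 \<and>
       t = Suc (t1 + t2))"
proof
  assume "\<exists>x t1 t2. run prg env e x t1 \<and> run prg env (if is_pair x then e1 else e2) y t2 \<and>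
    t = Suc (t1 + t2)"
  then obtain x t1 t2 where "run prg env e x t1"
    "run prg env (if is_pair x then e1 else e2) y t2" "t = Suc (t1 + t2)"
    by blast
  then show "run prg env (IfE e e1 e2) y t"
    by (cases "is_pair x") (simp_all add: run_If_True run_If_False)
qed (erule run_elims(7); metis)

lemma wp_If:
  "wp prg env (IfE e e1 e2) Q \<longleftrightarrow>
     wp prg env e (\<lambda>x t1. wp prg env (if is_pair x then e1 else e2) (\<lambda>y t2. Q y (Suc (t1 + t2))))"
  unfolding wp_def run_If_iff by blast

lemma wp_Let:
  "wp prg env (LetE e1 e2) Q \<longleftrightarrow>
     wp prg env e1 (\<lambda>x t1. wp prg (x # env) e2 (\<lambda>y t2. Q y (Suc (t1 + t2))))"
  unfolding wp_def by (blast intro: run_Let elim: run_elims)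

lemma wp_Call:
  "wp prg env (CallE i es) Q \<longleftrightarrow>
     wps prg env es (\<lambda>xs t1. i < length prg \<and> wp prg xs (prg ! i) (\<lambda>y t2. Q y (Suc (t1 + t2))))"
  unfolding wp_def wps_def by (blast intro: run_Call elim: run_elims)

lemma wps_Nil: "wps prg env [] Q \<longleftrightarrow> Q [] 0"
  unfolding wps_def by (auto intro: runs_Nil elim: run_elims)

lemma wps_Cons:
  "wps prg env (e # es) Q \<longleftrightarrow>
     wp prg env e (\<lambda>x t1. wps prg env es (\<lambda>xs t2. Q (x # xs) (t1 + t2)))"
  unfolding wp_def wps_def by (blast intro: runs_Cons elim: run_elims)

section \<open>The routines\<close>

abbreviation TrueE :: expr where "TrueE \<equiv> PairE NilE NilE"
abbreviation NotE :: "expr \<Rightarrow> expr" where "NotE e \<equiv> IfE e NilE TrueE"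
abbreviation AndE :: "expr \<Rightarrow> expr \<Rightarrow> expr" where "AndE e e' \<equiv> IfE e e' NilE"
abbreviation OrE :: "expr \<Rightarrow> expr \<Rightarrow> expr" where "OrE e e' \<equiv> IfE e TrueE e'"
abbreviation IffE :: "expr \<Rightarrow> expr \<Rightarrow> expr" where "IffE e e' \<equiv> IfE e e' (NotE e')"
abbreviation XorE :: "expr \<Rightarrow> expr \<Rightarrow> expr" where "XorE e e' \<equiv> IfE e (NotE e') e'"

datatype routine =
    Main | Nth | Snoc | Power2 | Add | Mult | Shift | Complement | Member | Clash
  | Literal_Value | Unit_Value | Combine | Fold | Node_Value | Evaluate | Enumerate

definition routines :: "routine list" where
  "routines = [Main, Nth, Snoc, Power2, Add, Mult, Shift, Complement, Member, Clash,
     Literal_Value, Unit_Value, Combine, Fold, Node_Value, Evaluate, Enumerate]"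

definition index :: "routine \<Rightarrow> nat" where
  "index r = length (takeWhile (\<lambda>r'. r' \<noteq> r) routines)"

abbreviation call :: "routine \<Rightarrow> expr list \<Rightarrow> expr" where
  "call r \<equiv> CallE (index r)"

abbreviation EvaluateE :: "expr \<Rightarrow> expr \<Rightarrow> expr" where
  "EvaluateE ctx dag \<equiv> call Evaluate [ctx, dag, NilE, dag, NilE]"

text \<open>
  From \<open>Literal_Value\<close> to \<open>Evaluate\<close>, an argument \<open>ctx\<close> selects the values attached to nodes:
  \<open>PairD NilD L\<close> asks for satisfiability under the literals \<open>L\<close>, and \<open>PairD (enc_bool True) \<alpha>\<close> for
  the number of models over \<open>\<alpha>\<close>.  An argument \<open>d\<close> tells disjunctions from conjunctions; \<open>Node_Value\<close>
  obtains it by stripping two units from the node tags 2 and 3.  The arguments are, in this order,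
  \<open>n, m, carry\<close> for \<open>Add\<close>; \<open>p, a, L\<close> for \<open>Member\<close>; \<open>ctx, p, a\<close> for \<open>Literal_Value\<close>;
  \<open>d, ctx\<close> for \<open>Unit_Value\<close>; \<open>d, ctx, x, y\<close> for \<open>Combine\<close>; \<open>d, ctx, values, children, x\<close> for \<open>Fold\<close>;
  \<open>ctx, dag, values, node\<close> for \<open>Node_Value\<close>; \<open>ctx, dag, values, nodes, x\<close> for \<open>Evaluate\<close>; and
  \<open>dag, \<alpha>, L, results\<close> for \<open>Enumerate\<close>.
\<close>

primrec body :: "expr \<Rightarrow> routine \<Rightarrow> expr" where
  "body main Main = main"
| "body main Nth = IfE (Var 1) (call Nth [SndE (Var 0), SndE (Var 1)]) (FstE (Var 0))"
| "body main Snoc = IfE (Var 0)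
     (PairE (FstE (Var 0)) (call Snoc [SndE (Var 0), Var 1]))
     (PairE (Var 1) NilE)"
| "body main Power2 = IfE (Var 0) (PairE NilE (call Power2 [SndE (Var 0)])) (PairE TrueE NilE)"
| "body main Add = IfE (OrE (Var 0) (Var 1))
     (PairE (XorE (XorE (FstE (Var 0)) (FstE (Var 1))) (Var 2))
       (call Add [SndE (Var 0), SndE (Var 1),
         IfE (FstE (Var 0)) (OrE (FstE (Var 1)) (Var 2)) (AndE (FstE (Var 1)) (Var 2))]))
     (IfE (Var 2) (PairE TrueE NilE) NilE)"
| "body main Mult = IfE (Var 1)
     (LetE (call Mult [Var 0, SndE (Var 1)])
       (LetE (call Add [Var 0, Var 0, NilE])
         (IfE (FstE (Var 3)) (call Add [Var 2, Var 0, NilE]) (Var 0))))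
     NilE"
| "body main Shift = IfE (Var 1) (call Shift [SndE (Var 0), SndE (Var 1)]) (Var 0)"
| "body main Complement = IfE (Var 0)
     (PairE (PairE (NotE (FstE (FstE (Var 0)))) (SndE (FstE (Var 0))))
       (call Complement [SndE (Var 0)]))
     NilE"
| "body main Member = AndE (Var 2)
     (OrE (AndE (IffE (Var 0) (FstE (FstE (Var 2)))) (EqE (Var 1) (SndE (FstE (Var 2)))))
       (call Member [Var 0, Var 1, SndE (Var 2)]))"
| "body main Clash = AndE (Var 0)
     (OrE (call Member [NotE (FstE (FstE (Var 0))), SndE (FstE (Var 0)), Var 1])
       (call Clash [SndE (Var 0), Var 1]))"
| "body main Literal_Value = IfE (FstE (Var 0))
     (call Power2 [SndE (SndE (Var 0))])
     (NotE (call Member [NotE (Var 1), Var 2, SndE (Var 0)]))"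
| "body main Unit_Value = IfE (Var 0) NilE (IfE (FstE (Var 1)) (call Power2 [SndE (Var 1)]) TrueE)"
| "body main Combine = IfE (FstE (Var 1))
     (IfE (Var 0)
       (call Add [Var 2, Var 3, NilE])
       (call Shift [call Mult [Var 2, Var 3], SndE (Var 1)]))
     (IfE (Var 0) (OrE (Var 2) (Var 3)) (AndE (Var 2) (Var 3)))"
| "body main Fold = IfE (Var 3)
     (call Fold [Var 0, Var 1, Var 2, SndE (Var 3),
       call Combine [Var 0, Var 1, Var 4, call Nth [Var 2, FstE (Var 3)]]])
     (Var 4)"
| "body main Node_Value = IfE (FstE (Var 3))
     (IfE (SndE (FstE (Var 3)))
       (LetE (SndE (SndE (FstE (Var 3))))
         (call Fold [Var 0, Var 1, Var 3, SndE (Var 4), call Unit_Value [Var 0, Var 1]]))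
       (call Literal_Value [Var 0, NilE, SndE (call Nth [Var 1, SndE (Var 3)])]))
     (call Literal_Value [Var 0, TrueE, SndE (Var 3)])"
| "body main Evaluate = IfE (Var 3)
     (LetE (call Node_Value [Var 0, Var 1, Var 2, FstE (Var 3)])
       (call Evaluate [Var 1, Var 2, call Snoc [Var 3, Var 0], SndE (Var 4), Var 0]))
     (Var 4)"
| "body main Enumerate = IfE (EvaluateE (PairE NilE (Var 2)) (Var 0))
     (IfE (Var 1)
       (call Enumerate [Var 0, SndE (Var 1), PairE (PairE TrueE (FstE (Var 1))) (Var 2),
         call Enumerate [Var 0, SndE (Var 1), PairE (PairE NilE (FstE (Var 1))) (Var 2), Var 3]])
       (PairE (Var 2) (Var 3)))
     (Var 3)"

definition program :: "expr \<Rightarrow> program" where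
  "program main = map (body main) routines"

lemma nth_program_index: "index r < length (program main) \<and> program main ! index r = body main r"
  by (cases r) (simp_all add: index_def program_def routines_def)

definition wp_routine ::
  "expr \<Rightarrow> routine \<Rightarrow> 'a data list \<Rightarrow> ('a data \<Rightarrow> nat \<Rightarrow> bool) \<Rightarrow> bool" where
  "wp_routine main r args = wp (program main) args (body main r)"

definition computes :: "expr \<Rightarrow> routine \<Rightarrow> 'a data list \<Rightarrow> 'a data \<Rightarrow> nat \<Rightarrow> bool" where
  "computes main r args out bound \<longleftrightarrow> wp_routine main r args (\<lambda>x t. x = out \<and> t \<le> bound)"

lemma wp_call:
  "wp (program main) env (call r es) Q \<longleftrightarrow>
     wps (program main) env es (\<lambda>xs t1. wp_routine main r xs (\<lambda>y t2. Q y (Suc (t1 + t2))))"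
  by (simp add: wp_Call wp_routine_def nth_program_index)

lemmas wp_simps = wp_Var wp_Nil wp_Pair wp_Fst wp_Snd wp_Eq wp_If wp_Let wp_call wps_Nil wps_Cons

lemma computesI:
  "wp (program main) args (body main r) (\<lambda>x t. x = out \<and> t \<le> bound) \<Longrightarrow>
   computes main r args out bound"
  by (simp add: computes_def wp_routine_def)

lemma computes_MainI:
  assumes "main = e" "wp (program main) args e (\<lambda>x t. x = out \<and> t \<le> bound)"
  shows "computes main Main args out bound"
  using assms by (simp add: computes_def wp_routine_def)

lemma computesD:
  assumes "computes main r args out bound" "\<And>t. t \<le> bound \<Longrightarrow> Q out t"
  shows "wp_routine main r args Q"
  using assms unfolding computes_def wp_routine_def wp_def by blast

lemma computes_mono:
  "computes main r args out bound \<Longrightarrow> bound \<le> bound' \<Longrightarrow> computes main r args out bound'"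
  by (auto simp: computes_def[of _ _ _ _ bound'] intro: computesD)

lemma outputs_within_program:
  assumes "computes main Main args out bound"
  shows "outputs_within (program main) args out bound"
  using assms unfolding computes_def wp_routine_def wp_def outputs_within_def
  by (auto simp: program_def routines_def)

section \<open>Lists and binary numbers\<close>

lemma enc_list_simps [simp]:
  "enc_list [] = NilD" "enc_list (x # xs) = PairD x (enc_list xs)"
  by (simp_all add: enc_list_def)

lemma enc_unary_simps [simp]:
  "enc_unary 0 = NilD" "enc_unary (Suc n) = PairD NilD (enc_unary n)"
  by (simp_all add: enc_unary_def)

lemma is_pair_enc_bool [simp]: "is_pair (enc_bool b) = b"
  by (simp add: enc_bool_def)

lemma enc_bool_eqs: "enc_bool True = PairD NilD NilD" "enc_bool False = NilD"
  by (simp_all add: enc_bool_def)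

lemma enc_binary_0 [simp]: "enc_binary 0 = NilD"
  by (simp add: enc_binary_def bits.simps)

lemma enc_binary_pos:
  "n > 0 \<Longrightarrow> enc_binary n = PairD (enc_bool (odd n)) (enc_binary (n div 2))"
  by (simp add: enc_binary_def bits.simps[of n])

lemma is_pair_enc_binary [simp]: "is_pair (enc_binary n) \<longleftrightarrow> n > 0"
  by (cases "n = 0") (simp_all add: enc_binary_pos)

lemma data_fst_enc_binary [simp]: "data_fst (enc_binary n) = enc_bool (odd n)"
  by (cases "n = 0") (simp_all add: enc_binary_pos enc_bool_eqs)

lemma data_snd_enc_binary [simp]: "data_snd (enc_binary n) = enc_binary (n div 2)"
  by (cases "n = 0") (simp_all add: enc_binary_pos)

lemma Nth_correct:
  "computes main Nth [enc_list (xs @ y # ys), enc_unary (length xs)] y (10 * Suc (length xs))"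
proof (induction xs)
  case Nil
  show ?case by (rule computesI) (simp add: wp_simps)
next
  case (Cons x xs)
  then show ?case by (intro computesI) (auto simp: wp_simps elim!: computesD)
qed

lemma Snoc_correct:
  "computes main Snoc [enc_list xs, y] (enc_list (xs @ [y])) (20 * Suc (length xs))"
proof (induction xs)
  case Nil
  show ?case by (rule computesI) (simp add: wp_simps)
next
  case (Cons x xs)
  then show ?case by (intro computesI) (auto simp: wp_simps elim!: computesD)
qed

lemma Power2_correct:
  "computes main Power2 [enc_list xs] (enc_binary (2 ^ length xs)) (20 * Suc (length xs))"
proof (induction xs)
  case Nil
  show ?case by (rule computesI) (simp add: wp_simps enc_binary_pos enc_bool_eqs)
next
  case (Cons x xs)
  then show ?case
    by (intro computesI) (auto simp: wp_simps enc_binary_pos enc_bool_eqs elim!: computesD)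
qed

lemma Shift_correct:
  "computes main Shift [enc_binary n, enc_list xs] (enc_binary (n div 2 ^ length xs))
     (20 * Suc (length xs))"
proof (induction xs arbitrary: n)
  case Nil
  show ?case by (rule computesI) (simp add: wp_simps)
next
  case (Cons x xs)
  from Cons[of "n div 2"] show ?case
    by (intro computesI) (auto simp: wp_simps div_mult2_eq elim!: computesD)
qed

definition majority :: "bool \<Rightarrow> bool \<Rightarrow> bool \<Rightarrow> bool" where
  "majority x y z \<longleftrightarrow> (if x then y \<or> z else y \<and> z)"

lemma add_with_carry_div2:
  fixes x y :: nat
  shows "(x + y + of_bool c) div 2 = x div 2 + y div 2 + of_bool (majority (odd x) (odd y) c)"
  by (cases c; cases "odd x"; cases "odd y") (auto simp: majority_def elim!: oddE evenE)

lemma Add_correct: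
  assumes "x < 2 ^ k" "y < 2 ^ k"
  shows "computes main Add [enc_binary x, enc_binary y, enc_bool c :: 'a data]
    (enc_binary (x + y + of_bool c)) (70 * Suc k)"
  using assms
proof (induction k arbitrary: x y c)
  case 0
  then show ?case
    by (intro computesI) (auto simp: wp_simps enc_binary_pos enc_bool_eqs)
next
  case (Suc k)
  show ?case
  proof (cases "x = 0 \<and> y = 0")
    case True
    then show ?thesis by (intro computesI) (auto simp: wp_simps enc_binary_pos enc_bool_eqs)
  next
    case False
    have recursive_call: "computes main Add
        [enc_binary (x div 2), enc_binary (y div 2),
          enc_bool (majority (odd x) (odd y) c) :: 'a data]
        (enc_binary ((x + y + of_bool c) div 2)) (70 * Suc k)"
      unfolding add_with_carry_div2 using Suc.prems by (intro Suc.IH) auto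
    have sum: "enc_binary (x + y + of_bool c) =
        PairD (enc_bool (odd (x + y + of_bool c))) (enc_binary ((x + y + of_bool c) div 2))"
      using False by (intro enc_binary_pos) auto
    show ?thesis unfolding sum using False recursive_call
      by (cases c; cases "odd x"; cases "odd y"; intro computesI)
        (auto simp: wp_simps enc_bool_eqs majority_def elim!: computesD)
  qed
qed

corollary Add_no_carry_correct:
  assumes "x < 2 ^ k" "y < 2 ^ k"
  shows "computes main Add [enc_binary x, enc_binary y, NilD] (enc_binary (x + y)) (70 * Suc k)"
  using Add_correct[OF assms, of main False] by (simp add: enc_bool_eqs)

definition Mult_time :: "nat \<Rightarrow> nat \<Rightarrow> nat" where
  "Mult_time j k = Suc k * (200 * Suc (j + k))"

lemma Mult_time_Suc: "Mult_time j k + 2 * (70 * Suc (j + Suc k)) + 30 \<le> Mult_time j (Suc k)"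
  by (simp add: Mult_time_def algebra_simps)

lemma Mult_correct:
  assumes "x < 2 ^ j" "y < 2 ^ k"
  shows "computes main Mult [enc_binary x, enc_binary y :: 'a data]
    (enc_binary (x * y)) (Mult_time j k)"
  using assms(2)
proof (induction k arbitrary: y)
  case 0
  then show ?case by (intro computesI) (auto simp: wp_simps Mult_time_def)
next
  case (Suc k)
  define r where "r = x * (y div 2)"
  have half: "y div 2 < 2 ^ k" using Suc.prems by auto
  have "r < 2 ^ j * 2 ^ k" unfolding r_def using assms(1) half by (intro mult_strict_mono) auto
  then have double_less: "r + r < 2 ^ (j + Suc k)" and r_less: "r < 2 ^ (j + Suc k)"
    by (simp_all add: power_add)
  have x_less: "x < 2 ^ (j + Suc k)"
    by (rule less_le_trans[OF assms(1)]) (rule power_increasing; simp)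
  note recursive_call = Suc.IH[OF half, folded r_def]
    and double = Add_no_carry_correct[OF r_less r_less, where 'a = 'a and main = main]
    and add_x = Add_no_carry_correct[OF x_less double_less, where 'a = 'a and main = main]
  show ?case
  proof (cases "y = 0")
    case True
    then show ?thesis by (intro computesI) (auto simp: wp_simps Mult_time_def)
  next
    case False
    have "x * y = (if odd y then x + (r + r) else r + r)"
      unfolding r_def by (cases "odd y") (auto elim!: evenE oddE simp: algebra_simps)
    with False Mult_time_Suc[of j k] show ?thesis
      by (cases "odd y"; intro computesI)
        (auto simp: wp_simps intro!: computesD[OF recursive_call] computesD[OF double]
          computesD[OF add_x])
  qed
qed

section \<open>Lists of literals\<close>

lemma enc_literal_literal [simp]: "enc_literal (literal p a) = PairD (enc_bool p) (Sym a)"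
  by (simp add: literal_def)

lemma enc_literals_simps [simp]:
  "enc_literals [] = NilD" "enc_literals (l # ls) = PairD (enc_literal l) (enc_literals ls)"
  by (simp_all add: enc_literals_def)

lemma literals_induct [consumes 1, case_names Nil Cons]:
  assumes "\<forall>l \<in> set ls. is_literal l"
    and "P []"
    and "\<And>q b ls. \<forall>l \<in> set ls. is_literal l \<Longrightarrow> P ls \<Longrightarrow> P (literal q b # ls)"
  shows "P ls"
  using assms(1) by (induction ls) (auto simp: is_literal_iff intro: assms(2,3))

lemma Complement_correct:
  assumes "\<forall>l \<in> set ls. is_literal l"
  shows "computes main Complement [enc_literals ls] (enc_literals (map complement ls))
    (20 * Suc (length ls))"
  using assms
proof (induction ls rule: literals_induct)
  case Nil
  show ?case by (rule computesI) (simp add: wp_simps)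
next
  case (Cons q b ls)
  then show ?case
    by (cases q; intro computesI) (auto simp: wp_simps enc_bool_eqs elim!: computesD)
qed

lemma Member_correct:
  assumes "\<forall>l \<in> set ls. is_literal l"
  shows "computes main Member [enc_bool p, Sym a, enc_literals ls]
    (enc_bool (literal p a \<in> set ls)) (60 * Suc (length ls))"
  using assms
proof (induction ls rule: literals_induct)
  case Nil
  show ?case by (rule computesI) (simp add: wp_simps enc_bool_eqs)
next
  case (Cons q b ls)
  then show ?case
    by (cases p; cases q; cases "a = b"; intro computesI)
      (auto simp: wp_simps enc_bool_eqs elim!: computesD)
qed

lemma Clash_correct:
  assumes "\<forall>l \<in> set ks. is_literal l" "\<forall>l \<in> set ls. is_literal l"
  shows "computes main Clash [enc_literals ks, enc_literals ls]
    (enc_bool (\<exists>l \<in> set ks. complement l \<in> set ls)) (Suc (length ks) * (60 * Suc (length ls) + 60))"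
  using assms(1)
proof (induction ks rule: literals_induct)
  case Nil
  show ?case by (rule computesI) (simp add: wp_simps enc_bool_eqs)
next
  case (Cons q b ks)
  then show ?case
    using Member_correct[OF assms(2), of main "\<not> q" b]
    by (cases q; cases "literal (\<not> q) b \<in> set ls"; intro computesI)
      (auto simp: wp_simps enc_bool_eqs elim!: computesD)
qed

section \<open>Bottom-up evaluation of a listing\<close>

lemma enc_node_junction:
  "enc_node ns (junction d S) = PairD (PairD NilD (PairD NilD (enc_bool d))) (enc_refs ns S)"
  by (simp add: junction_def eval_nat_numeral enc_bool_eqs)

lemma nth_position:
  assumes "distinct ns" "g \<in> set ns"
  shows "ns ! position ns g = g"
proof -
  obtain xs ys where "ns = xs @ g # ys" using assms(2) by (auto dest: split_list)
  with assms(1) show ?thesis by (simp add: position_append)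
qed

lemma enc_refs_eq_list:
  assumes "distinct ns" "fset S \<subseteq> set ns"
  obtains gs where "distinct gs" "set gs = fset S" "enc_refs ns S = enc_list (map (enc_ref ns) gs)"
proof -
  define rs where "rs = sorted_list_of_set (position ns ` fset S)"
  have rs: "set rs = position ns ` fset S" "distinct rs" by (simp_all add: rs_def)
  have nth: "ns ! position ns g = g" if "g |\<in>| S" for g
    using that assms by (intro nth_position) auto
  show thesis
  proof
    show "distinct (map ((!) ns) rs)"
      using rs nth by (auto simp: distinct_map inj_on_def)
    show "set (map ((!) ns) rs) = fset S" using rs(1) nth by force
    have "enc_ref ns (ns ! r) = enc_unary r" if "r \<in> set rs" for r
      using that rs(1) nth by (auto simp: enc_ref_def)
    then have "map (enc_ref ns) (map ((!) ns) rs) = map enc_unary rs" by simp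
    then show "enc_refs ns S = enc_list (map (enc_ref ns) (map ((!) ns) rs))"
      by (simp only: enc_refs_def rs_def)
  qed
qed

lemma lookup_correct:
  assumes "distinct (xs @ ys)" "g \<in> set xs"
  shows "computes main Nth [enc_list (map h xs), enc_ref (xs @ ys) g] (h g) (10 * Suc (length xs))"
proof -
  obtain us vs where xs: "xs = us @ g # vs" using assms(2) by (auto dest: split_list)
  have "enc_ref (xs @ ys) g = enc_unary (length (map h us))"
    using assms(1) position_append[of us g "vs @ ys"] by (simp add: enc_ref_def xs)
  moreover have "computes main Nth
      [enc_list (map h us @ h g # map h vs), enc_unary (length (map h us))] (h g)
      (10 * Suc (length (map h us)))"
    by (rule Nth_correct)
  ultimately show ?thesis by (auto simp: xs elim: computes_mono)
qed

definition Fold_time :: "nat \<Rightarrow> nat \<Rightarrow> nat" where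
  "Fold_time s step = Suc s * (10 * Suc s + step + 40)"

definition Node_Value_time :: "nat \<Rightarrow> nat \<Rightarrow> nat" where
  "Node_Value_time s step = Fold_time s step + 10 * Suc s + step + 60"

definition Evaluate_time :: "nat \<Rightarrow> nat \<Rightarrow> nat" where
  "Evaluate_time s step = Suc s * (Node_Value_time s step + 20 * Suc s + 60)"

lemma Evaluate_time_mono:
  "s \<le> s' \<Longrightarrow> step \<le> step' \<Longrightarrow> Evaluate_time s step \<le> Evaluate_time s' step'"
  unfolding Evaluate_time_def Node_Value_time_def Fold_time_def
  by (intro mult_le_mono add_le_mono) auto

abbreviation evaluates :: "expr \<Rightarrow> 'a data \<Rightarrow> 'a form list \<Rightarrow> 'a data \<Rightarrow> nat \<Rightarrow> bool" where
  "evaluates main ctx ns \<equiv> computes main Evaluate [ctx, enc_dag ns, NilD, enc_dag ns, NilD]"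

text \<open>
  In \<open>Combine_correct\<close>, \<open>junction d F\<close> joins the children visited so far and need not be a node.
\<close>

locale node_values =
  fixes main :: expr and ctx :: "'a data" and \<psi> :: "'a form" and ns :: "'a form list"
    and val :: "'a form \<Rightarrow> 'a data" and step :: nat
  assumes listing: "dag_listing \<psi> ns" and nnf: "nnf \<psi>"
    and Unit_Value_correct:
      "computes main Unit_Value [enc_bool d, ctx] (val (junction d {||})) step"
    and Combine_correct:
      "junction d S \<in> subforms \<psi> \<Longrightarrow> finsert g F |\<subseteq>| S \<Longrightarrow> g |\<notin>| F \<Longrightarrow>
       computes main Combine [enc_bool d, ctx, val (junction d F), val g]
         (val (junction d (finsert g F))) step"
    and Literal_Value_correct:
      "literal p a \<in> subforms \<psi> \<Longrightarrow>
       computes main Literal_Value [ctx, enc_bool p, Sym a] (val (literal p a)) step"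
begin

lemma distinct_listing: "distinct ns" and set_listing: "set ns = subforms \<psi>"
  using listing by (simp_all add: dag_listing_def)

lemma Fold_correct:
  assumes "junction d S \<in> subforms \<psi>" "ns = xs @ ys"
    and "distinct gs" "set gs \<subseteq> set xs" "F |\<union>| fset_of_list gs |\<subseteq>| S" "fset F \<inter> set gs = {}"
  shows "computes main Fold
    [enc_bool d, ctx, enc_list (map val xs), enc_list (map (enc_ref ns) gs), val (junction d F)]
    (val (junction d (F |\<union>| fset_of_list gs)))
    (Suc (length gs) * (10 * Suc (length ns) + step + 40))"
  using assms(3-)
proof (induction gs arbitrary: F)
  case Nil
  show ?case by (rule computesI) (simp add: wp_simps)
next
  case (Cons g gs)
  have "computes main Nth [enc_list (map val xs), enc_ref ns g] (val g) (10 * Suc (length xs))"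
    unfolding assms(2) using distinct_listing Cons.prems(2)
    by (intro lookup_correct) (auto simp: assms(2))
  then have child_value: "computes main Nth [enc_list (map val xs), enc_ref ns g] (val g)
      (10 * Suc (length ns))"
    by (rule computes_mono) (simp add: assms(2))
  have combine: "computes main Combine [enc_bool d, ctx, val (junction d F), val g]
      (val (junction d (finsert g F))) step"
    using Cons.prems(3,4) by (intro Combine_correct[OF assms(1)]) (auto simp: fset_of_list.rep_eq)
  have recursive_call: "computes main Fold
      [enc_bool d, ctx, enc_list (map val xs), enc_list (map (enc_ref ns) gs),
        val (junction d (finsert g F))]
      (val (junction d (F |\<union>| fset_of_list (g # gs))))
      (Suc (length gs) * (10 * Suc (length ns) + step + 40))"
    using Cons.IH[of "finsert g F"] Cons.prems by simp
  show ?case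
    by (intro computesI)
      (auto simp: wp_simps
        intro!: computesD[OF child_value[unfolded One_nat_def]] computesD[OF combine]
          computesD[OF recursive_call])
qed

lemma Fold_children_correct:
  assumes "ns = xs @ junction d S # ys"
  shows "computes main Fold
    [enc_bool d, ctx, enc_list (map val xs), enc_refs ns S, val (junction d {||})]
    (val (junction d S)) (Fold_time (length ns) step)"
proof -
  have children: "fset S \<subseteq> set xs"
    using dag_listing_children[of \<psi> xs "junction d S" ys] listing assms by simp
  then have "fset S \<subseteq> set ns" using assms by auto
  with distinct_listing obtain gs where gs: "distinct gs" "set gs = fset S"
    and refs: "enc_refs ns S = enc_list (map (enc_ref ns) gs)"
    by (rule enc_refs_eq_list)
  have S: "fset_of_list gs = S" using gs(2) by (simp add: fset_of_list.rep_eq fset_eq_iff)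
  have "junction d S \<in> subforms \<psi>" using set_listing assms by auto
  then have "computes main Fold
      [enc_bool d, ctx, enc_list (map val xs), enc_list (map (enc_ref ns) gs),
        val (junction d {||})]
      (val (junction d ({||} |\<union>| fset_of_list gs)))
      (Suc (length gs) * (10 * Suc (length ns) + step + 40))"
    using assms gs children by (intro Fold_correct[of d S]) (auto simp: S)
  moreover have "length gs \<le> length ns"
    using distinct_card[OF gs(1)] distinct_card[OF distinct_listing] gs(2) children assms
    by (metis List.finite_set card_mono le_supI1 set_append)
  ultimately show ?thesis
    unfolding refs Fold_time_def S by (auto elim!: computes_mono intro: mult_le_mono)
qed

lemma Node_Value_literal_correct:
  assumes "ns = xs @ literal p a # ys"
  shows "computes main Node_Value
    [ctx, enc_dag ns, enc_list (map val xs), enc_node ns (literal p a)] (val (literal p a))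
    (Node_Value_time (length ns) step)"
proof -
  have "literal p a \<in> subforms \<psi>" using set_listing assms by auto
  then have literal_value:
      "computes main Literal_Value [ctx, enc_bool p, Sym a] (val (literal p a)) step"
    by (rule Literal_Value_correct)
  show ?thesis
  proof (cases p)
    case True
    with literal_value show ?thesis
      by (intro computesI)
        (auto simp: wp_simps literal_def enc_bool_eqs Node_Value_time_def elim!: computesD)
  next
    case False
    have "Atom a \<in> set ns"
      using dag_listing_children[of \<psi> xs "literal p a" ys] listing assms False
      by (auto simp: literal_def)
    then have "computes main Nth [enc_dag ns, enc_ref ns (Atom a)] (enc_node ns (Atom a))
        (10 * Suc (length ns))"
      using lookup_correct[of ns "[]" "Atom a" main "enc_node ns"] distinct_listing
      by (simp add: enc_dag_def)
    with False literal_value show ?thesis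
      by (intro computesI)
        (auto simp: wp_simps literal_def enc_bool_eqs Node_Value_time_def elim!: computesD)
  qed
qed

lemma Node_Value_correct:
  assumes "ns = xs @ g # ys"
  shows "computes main Node_Value [ctx, enc_dag ns, enc_list (map val xs), enc_node ns g] (val g)
    (Node_Value_time (length ns) step)"
proof -
  have "g \<in> subforms \<psi>" using set_listing assms by auto
  with nnf show ?thesis
  proof (cases rule: nnf_cases)
    case (literal p a)
    then show ?thesis using Node_Value_literal_correct assms by simp
  next
    case (junction d S)
    then have ns: "ns = xs @ junction d S # ys" using assms by simp
    show ?thesis
      unfolding junction enc_node_junction
      by (intro computesI)
        (auto simp: wp_simps Node_Value_time_def
          intro!: computesD[OF Unit_Value_correct] computesD[OF Fold_children_correct[OF ns]])
  qed
qed

lemma Evaluate_from_correct: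
  assumes "ns = xs @ ys"
  shows "computes main Evaluate
    [ctx, enc_dag ns, enc_list (map val xs), enc_list (map (enc_node ns) ys), x]
    (last (x # map val ys))
    (Suc (length ys) * (Node_Value_time (length ns) step + 20 * Suc (length ns) + 60))"
  using assms
proof (induction ys arbitrary: xs x)
  case Nil
  show ?case by (rule computesI) (simp add: wp_simps)
next
  case (Cons g ys)
  note node_value = Node_Value_correct[OF Cons.prems]
  have "computes main Snoc [enc_list (map val xs), val g] (enc_list (map val (xs @ [g])))
      (20 * Suc (length (map val xs)))"
    using Snoc_correct[of main "map val xs" "val g"] by simp
  then have snoc: "computes main Snoc [enc_list (map val xs), val g] (enc_list (map val (xs @ [g])))
      (20 * Suc (length ns))"
    by (rule computes_mono) (simp add: Cons.prems)
  have recursive_call: "computes main Evaluate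
      [ctx, enc_dag ns, enc_list (map val (xs @ [g])), enc_list (map (enc_node ns) ys), val g]
      (last (val g # map val ys))
      (Suc (length ys) * (Node_Value_time (length ns) step + 20 * Suc (length ns) + 60))"
    using Cons.prems by (intro Cons.IH) simp
  have "last (x # map val (g # ys)) = last (val g # map val ys)" by simp
  then show ?case
    by (intro computesI)
      (auto simp: wp_simps simp del: map_append last.simps
        intro!: computesD[OF node_value] computesD[OF snoc] computesD[OF recursive_call])
qed

lemma Evaluate_correct:
  "evaluates main ctx ns (val \<psi>) (Evaluate_time (dag_size \<psi>) step)"
  using Evaluate_from_correct[of "[]" ns NilD] dag_listing_last[OF listing]
    dag_listing_length[OF listing]
  by (simp add: enc_dag_def Evaluate_time_def last_map)

end

section \<open>Evaluating satisfiability and model counts\<close>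

abbreviation sat_ctx :: "'a form list \<Rightarrow> 'a data" where
  "sat_ctx ls \<equiv> PairD NilD (enc_literals ls)"

abbreviation count_ctx :: "'a list \<Rightarrow> 'a data" where
  "count_ctx as \<equiv> PairD (enc_bool True) (enc_atoms as)"

lemma Combine_bool_correct:
  "computes main Combine [enc_bool d, sat_ctx ls, enc_bool b, enc_bool b']
     (enc_bool (if d then b \<or> b' else b \<and> b')) 60"
  by (cases d; cases b; intro computesI) (simp_all add: wp_simps enc_bool_eqs)

lemma satisfiable_with_node_values:
  assumes "d_DNNF \<psi>" "dag_listing \<psi> ns" "partial_assignment (set ls)"
  shows "node_values main (sat_ctx ls) \<psi> ns (\<lambda>f. enc_bool (satisfiable_with (set ls) f))
    (60 * Suc (length ls) + 60)"
proof
  show "dag_listing \<psi> ns" by (rule assms(2))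
  show "nnf \<psi>" using assms(1) by (simp add: d_DNNF_def)
  have "decomposable \<psi>" using assms(1) by (simp add: d_DNNF_def)
  have literals: "\<forall>l \<in> set ls. is_literal l" using assms(3) by (simp add: partial_assignment_def)
  show "computes main Unit_Value [enc_bool d, sat_ctx ls]
      (enc_bool (satisfiable_with (set ls) (junction d {||}))) (60 * Suc (length ls) + 60)" for d
    using satisfiable_with_And_empty[OF assms(3)] satisfiable_with_Or_empty[of "set ls"]
    by (cases d; intro computesI) (simp_all add: junction_def wp_simps enc_bool_eqs)
  show "computes main Combine [enc_bool d, sat_ctx ls,
      enc_bool (satisfiable_with (set ls) (junction d F)), enc_bool (satisfiable_with (set ls) g)]
      (enc_bool (satisfiable_with (set ls) (junction d (finsert g F)))) (60 * Suc (length ls) + 60)"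
    if "junction d S \<in> subforms \<psi>" "finsert g F |\<subseteq>| S" "g |\<notin>| F" for d S g F
    unfolding satisfiable_with_junction_finsert[OF \<open>decomposable \<psi>\<close> that literals]
    by (rule computes_mono[OF Combine_bool_correct]) simp
  show "computes main Literal_Value [sat_ctx ls, enc_bool p, Sym a]
      (enc_bool (satisfiable_with (set ls) (literal p a))) (60 * Suc (length ls) + 60)" for p a
    using Member_correct[OF literals, of main "\<not> p" a]
    unfolding satisfiable_with_literal[OF assms(3)]
    by (cases p; cases "literal (\<not> p) a \<in> set ls"; intro computesI)
      (auto simp: wp_simps enc_bool_eqs elim!: computesD)
qed

definition sat_time :: "nat \<Rightarrow> nat \<Rightarrow> nat" where
  "sat_time s n = Evaluate_time s (60 * Suc n + 60)"

lemma sat_time_mono: "s \<le> s' \<Longrightarrow> n \<le> n' \<Longrightarrow> sat_time s n \<le> sat_time s' n'"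
  unfolding sat_time_def by (rule Evaluate_time_mono) auto

lemma Evaluate_sat_correct:
  assumes "d_DNNF \<psi>" "dag_listing \<psi> ns" "partial_assignment (set ls)"
  shows "evaluates main (sat_ctx ls) ns
    (enc_bool (satisfiable_with (set ls) \<psi>)) (sat_time (dag_size \<psi>) (length ls))"
  unfolding sat_time_def
  using satisfiable_with_node_values[OF assms] by (rule node_values.Evaluate_correct)

definition arith_time :: "nat \<Rightarrow> nat" where
  "arith_time n = Mult_time (Suc n) (Suc n) + 100 * Suc (Suc n) + 60"

lemma Combine_binary_correct:
  assumes "x \<le> 2 ^ length as" "y \<le> 2 ^ length as"
  shows "computes main Combine [enc_bool d, count_ctx as, enc_binary x, enc_binary y :: 'a data]
    (enc_binary (if d then x + y else x * y div 2 ^ length as)) (arith_time (length as))"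
proof -
  have xy: "x < 2 ^ Suc (length as)" "y < 2 ^ Suc (length as)"
    using assms by (auto intro: le_less_trans)
  have "computes main Shift [enc_binary (x * y), enc_atoms as]
      (enc_binary (x * y div 2 ^ length as)) (20 * Suc (length as))"
    using Shift_correct[of main "x * y" "map Sym as"] by (simp add: enc_atoms_def)
  with Add_no_carry_correct[OF xy, of main] Mult_correct[OF xy, of main] show ?thesis
    by (cases d; intro computesI) (auto simp: wp_simps enc_bool_eqs arith_time_def elim!: computesD)
qed

lemma count_node_values:
  assumes "d_DNNF \<psi>" "dag_listing \<psi> ns" "distinct as" "atoms \<psi> \<subseteq> set as"
  shows "node_values main (count_ctx as) \<psi> ns (\<lambda>f. enc_binary (card (models (set as) f)))
    (arith_time (length as))"
proof
  show "dag_listing \<psi> ns" by (rule assms(2))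
  show "nnf \<psi>" using assms(1) by (simp add: d_DNNF_def)
  have "decomposable \<psi>" "deterministic \<psi>" using assms(1) by (simp_all add: d_DNNF_def)
  have card: "card (set as) = length as" using assms(3) by (rule distinct_card)
  have le: "card (models (set as) f) \<le> 2 ^ length as" for f
    using card_models_le[of "set as" f] by (simp add: card)
  have "card (models (set as) (junction d {||})) = (if d then 0 else 2 ^ length as)" for d
    by (simp add: junction_def card_models_And_empty card_models_Or_empty card)
  then show "computes main Unit_Value [enc_bool d, count_ctx as]
      (enc_binary (card (models (set as) (junction d {||})))) (arith_time (length as))" for d
    using Power2_correct[of main "map Sym as"]
    by (intro computesI) (auto simp: wp_simps enc_atoms_def arith_time_def elim!: computesD)
  show "computes main Combine [enc_bool d, count_ctx as,
      enc_binary (card (models (set as) (junction d F))), enc_binary (card (models (set as) g))]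
      (enc_binary (card (models (set as) (junction d (finsert g F))))) (arith_time (length as))"
    if "junction d S \<in> subforms \<psi>" "finsert g F |\<subseteq>| S" "g |\<notin>| F" for d S g F
    unfolding card card_models_junction_finsert
      [OF \<open>decomposable \<psi>\<close> \<open>deterministic \<psi>\<close> that List.finite_set]
    by (rule Combine_binary_correct[OF le le])
  show "computes main Literal_Value [count_ctx as, enc_bool p, Sym a]
      (enc_binary (card (models (set as) (literal p a)))) (arith_time (length as))"
    if "literal p a \<in> subforms \<psi>" for p a
  proof -
    have "a \<in> set as" using that atoms_subforms assms(4) by fastforce
    then obtain b bs where as: "as = b # bs" by (cases as) auto
    have "card (models (set as) (literal p a)) = 2 ^ length bs"
      using card_models_literal[of "set as" a p] \<open>a \<in> set as\<close> card as by simp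
    then show ?thesis
      using Power2_correct[of main "map Sym bs"]
      by (intro computesI) (auto simp: as wp_simps enc_atoms_def arith_time_def elim!: computesD)
  qed
qed

definition count_time :: "nat \<Rightarrow> nat \<Rightarrow> nat" where
  "count_time s n = Evaluate_time s (arith_time n)"

lemma count_time_mono: "s \<le> s' \<Longrightarrow> n \<le> n' \<Longrightarrow> count_time s n \<le> count_time s' n'"
  unfolding count_time_def arith_time_def Mult_time_def
  by (intro Evaluate_time_mono mult_le_mono add_le_mono) auto

lemma Evaluate_count_correct:
  assumes "d_DNNF \<psi>" "dag_listing \<psi> ns" "distinct as" "atoms \<psi> \<subseteq> set as"
  shows "evaluates main (count_ctx as) ns
    (enc_binary (card (models (set as) \<psi>))) (count_time (dag_size \<psi>) (length as))"
  unfolding count_time_def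
  using count_node_values[OF assms] by (rule node_values.Evaluate_correct)

section \<open>The enumeration routine\<close>

lemma Enumerate_unsatisfiable_correct:
  assumes "d_DNNF \<psi>" "dag_listing \<psi> ns" "partial_assignment (set ls)"
    and "\<not> satisfiable_with (set ls) \<psi>"
  shows "computes main Enumerate [enc_dag ns, enc_atoms as, enc_literals ls, results] results
    (sat_time (dag_size \<psi>) (length ls) + 80)"
  using Evaluate_sat_correct[OF assms(1-3), of main] assms(4)
  by (intro computesI) (auto simp: wp_simps enc_bool_eqs elim!: computesD)

lemma Enumerate_branch_correct:
  assumes "evaluates main (sat_ctx ls) ns (enc_bool True) t"
    and "computes main Enumerate
      [enc_dag ns, enc_atoms as, enc_literals (literal False a # ls), results] results' t0"
    and "computes main Enumerate
      [enc_dag ns, enc_atoms as, enc_literals (literal True a # ls), results'] results'' t1"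
  shows "computes main Enumerate
    [enc_dag ns, enc_atoms (a # as), enc_literals ls, results] results'' (t + t0 + t1 + 80)"
  using assms
  by (intro computesI) (auto simp: wp_simps enc_atoms_def enc_bool_eqs elim!: computesD)

lemma Enumerate_correct:
  fixes as :: "'a list"
  assumes "d_DNNF \<psi>" "dag_listing \<psi> ns"
    and "distinct as" "partial_assignment (set ls)" "set as \<inter> \<Union>(atoms ` set ls) = {}"
  shows "computes main Enumerate [enc_dag ns, enc_atoms as, enc_literals ls, enc_list zs]
    (enc_list (map enc_literals (extensions \<psi> as ls) @ zs))
    ((sat_time (dag_size \<psi>) (length as + length ls) + 80) * extension_calls \<psi> as ls)"
  using assms(3-)
proof (induction as arbitrary: ls zs)
  case Nil
  with Evaluate_sat_correct[OF assms(1,2), of ls main] show ?case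
    by (cases "satisfiable_with (set ls) \<psi>"; intro computesI)
      (auto simp: wp_simps enc_atoms_def enc_bool_eqs elim!: computesD)
next
  case (Cons a as)
  define t where "t = sat_time (dag_size \<psi>) (length (a # as) + length ls)"
  have t: "sat_time (dag_size \<psi>) (length ls) \<le> t" unfolding t_def by (rule sat_time_mono) simp_all
  show ?case
  proof (cases "satisfiable_with (set ls) \<psi>")
    case False
    from computes_mono[OF Enumerate_unsatisfiable_correct[OF assms(1,2) Cons.prems(2) False]
        add_right_mono[OF t]] False
    show ?thesis unfolding t_def[symmetric] by simp
  next
    case True
    have test: "evaluates main (sat_ctx ls) ns (enc_bool True) t"
      using Evaluate_sat_correct[OF assms(1,2) Cons.prems(2), of main] True t
      by (auto elim: computes_mono)
    have recursive_call: "computes main Enumerate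
        [enc_dag ns, enc_atoms as, enc_literals (literal p a # ls), enc_list zs]
        (enc_list (map enc_literals (extensions \<psi> as (literal p a # ls)) @ zs))
        ((t + 80) * extension_calls \<psi> as (literal p a # ls))" for p zs
      using Cons.IH[of "literal p a # ls" zs] Cons.prems partial_assignment_insert[of "set ls" a p]
      by (simp add: t_def)
    from Enumerate_branch_correct[OF test recursive_call[of False] recursive_call[of True]] True
    show ?thesis unfolding t_def[symmetric] by (simp add: algebra_simps)
  qed
qed

section \<open>Polynomial bounds\<close>

definition is_polynomial :: "(nat \<Rightarrow> nat) \<Rightarrow> bool" where
  "is_polynomial f \<longleftrightarrow> (\<exists>p. f = poly p)"

lemma is_polynomial_const: "is_polynomial (\<lambda>_. k)"
  unfolding is_polynomial_def by (intro exI[of _ "[:k:]"]) (simp add: fun_eq_iff)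

lemma is_polynomial_id: "is_polynomial (\<lambda>n. n)"
  unfolding is_polynomial_def by (intro exI[of _ "[:0, 1:]"]) (simp add: fun_eq_iff)

lemma is_polynomial_add:
  assumes "is_polynomial f" "is_polynomial g"
  shows "is_polynomial (\<lambda>n. f n + g n)"
proof -
  obtain p q where "f = poly p" "g = poly q" using assms unfolding is_polynomial_def by blast
  then have "(\<lambda>n. f n + g n) = poly (p + q)" by (simp add: fun_eq_iff)
  then show ?thesis unfolding is_polynomial_def by blast
qed

lemma is_polynomial_mult:
  assumes "is_polynomial f" "is_polynomial g"
  shows "is_polynomial (\<lambda>n. f n * g n)"
proof -
  obtain p q where "f = poly p" "g = poly q" using assms unfolding is_polynomial_def by blast
  then have "(\<lambda>n. f n * g n) = poly (p * q)" by (simp add: fun_eq_iff)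
  then show ?thesis unfolding is_polynomial_def by blast
qed

lemma is_polynomial_Suc: "is_polynomial f \<Longrightarrow> is_polynomial (\<lambda>n. Suc (f n))"
  using is_polynomial_add[OF _ is_polynomial_const, of f 1] by simp

lemmas is_polynomial_intros =
  is_polynomial_const is_polynomial_id is_polynomial_add is_polynomial_mult is_polynomial_Suc

lemma is_polynomial_Evaluate_time:
  "is_polynomial f \<Longrightarrow> is_polynomial g \<Longrightarrow> is_polynomial (\<lambda>n. Evaluate_time (f n) (g n))"
  unfolding Evaluate_time_def Node_Value_time_def Fold_time_def by (intro is_polynomial_intros)

lemma is_polynomial_sat_time: "is_polynomial (\<lambda>n. sat_time n n)"
  unfolding sat_time_def by (intro is_polynomial_Evaluate_time is_polynomial_intros)

lemma is_polynomial_count_time: "is_polynomial (\<lambda>n. count_time n n)"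
  unfolding count_time_def arith_time_def Mult_time_def
  by (intro is_polynomial_Evaluate_time is_polynomial_intros)

section \<open>The four queries\<close>

definition T_sat_main :: expr where
  "T_sat_main = EvaluateE (PairE NilE NilE) (Var 0)"

definition T_entails_main :: expr where
  "T_entails_main = LetE (call Complement [Var 1])
     (OrE (call Clash [Var 0, Var 0]) (NotE (EvaluateE (PairE NilE (Var 0)) (Var 1))))"

definition count_SMT_main :: expr where
  "count_SMT_main = EvaluateE (PairE TrueE (Var 1)) (Var 0)"

definition AllSMT_main :: expr where
  "AllSMT_main = call Enumerate [Var 0, Var 1, NilE, NilE]"

definition T_sat_time :: "nat \<Rightarrow> nat" where
  "T_sat_time n = sat_time n n + 30"

definition T_entails_time :: "nat \<Rightarrow> nat \<Rightarrow> nat" where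
  "T_entails_time s n = sat_time s n + Suc n * (60 * Suc n + 60) + 20 * Suc n + 80"

definition count_SMT_time :: "nat \<Rightarrow> nat" where
  "count_SMT_time n = count_time n n + 30"

definition AllSMT_time :: "nat \<Rightarrow> nat" where
  "AllSMT_time n = (sat_time n n + 80) * (1 + 2 * n * n) + 30"

lemma is_polynomial_query_times:
  "is_polynomial T_sat_time" "is_polynomial (\<lambda>n. T_entails_time n n)"
  "is_polynomial count_SMT_time" "is_polynomial AllSMT_time"
  unfolding T_sat_time_def T_entails_time_def count_SMT_time_def AllSMT_time_def
  by (intro is_polynomial_intros is_polynomial_sat_time is_polynomial_count_time)+

locale T_reduced_dag = T_reduced_form T \<alpha> \<psi>
  for T :: "('m, 't) smt_theory" and \<alpha> :: "('t, 'b) atom set" and \<psi> :: "('t, 'b) atom form" +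
  fixes ns :: "('t, 'b) atom form list"
  assumes d_DNNF: "d_DNNF \<psi>" and listing: "dag_listing \<psi> ns"
begin

lemma T_sat_main_correct:
  "computes T_sat_main Main [enc_dag ns] (enc_bool (T_sat T \<psi>)) (T_sat_time (dag_size \<psi>))"
proof -
  have "evaluates T_sat_main (sat_ctx []) ns (enc_bool (T_sat T \<psi>)) (sat_time (dag_size \<psi>) 0)"
    using Evaluate_sat_correct[OF d_DNNF listing, of "[]" T_sat_main] partial_assignment_empty
    by (simp add: T_sat_iff)
  then have "evaluates T_sat_main (sat_ctx []) ns
      (enc_bool (T_sat T \<psi>)) (sat_time (dag_size \<psi>) (dag_size \<psi>))"
    by (rule computes_mono) (simp add: sat_time_mono)
  then show ?thesis
    by (intro computes_MainI[OF T_sat_main_def])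
      (auto simp: wp_simps T_sat_time_def elim!: computesD)
qed

lemma T_entails_main_evaluates:
  assumes literals: "\<forall>l \<in> set ls. is_literal l"
  shows "computes T_entails_main Main [enc_dag ns, enc_literals ls]
    (enc_bool (\<not> satisfiable_with (complement ` set ls) \<psi>))
    (T_entails_time (dag_size \<psi>) (length ls))"
proof -
  define ks where "ks = map complement ls"
  have set_ks: "complement ` set ls = set ks" by (simp add: ks_def)
  define clash where "clash \<longleftrightarrow> (\<exists>l \<in> set ks. complement l \<in> set ks)"
  have literals_ks: "\<forall>l \<in> set ks. is_literal l"
    using literals by (simp add: ks_def is_literal_complement)
  have complements: "computes T_entails_main Complement [enc_literals ls] (enc_literals ks)
      (20 * Suc (length ls))"
    unfolding ks_def using literals by (rule Complement_correct)
  have clashes: "computes T_entails_main Clash [enc_literals ks, enc_literals ks]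
      (enc_bool clash) (Suc (length ls) * (60 * Suc (length ls) + 60))"
    using Clash_correct[OF literals_ks literals_ks, of T_entails_main]
    by (simp only: clash_def ks_def length_map)
  note calls = computesD[OF complements] computesD[OF clashes]
  show ?thesis
  proof (cases clash)
    case True
    then have "\<not> satisfiable_with (set ks) \<psi>"
      unfolding clash_def using not_satisfiable_with_complementary by blast
    with True show ?thesis unfolding set_ks
      by (intro computes_MainI[OF T_entails_main_def])
        (auto simp: wp_simps enc_bool_eqs T_entails_time_def intro!: calls)
  next
    case False
    then have "partial_assignment (set ks)"
      using literals_ks by (auto simp: clash_def partial_assignment_def)
    from Evaluate_sat_correct[OF d_DNNF listing this, of T_entails_main]
    have evaluate: "evaluates T_entails_main (sat_ctx ks) ns
        (enc_bool (satisfiable_with (set ks) \<psi>)) (sat_time (dag_size \<psi>) (length ls))"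
      by (simp add: ks_def)
    from False show ?thesis unfolding set_ks
      by (cases "satisfiable_with (set ks) \<psi>"; intro computes_MainI[OF T_entails_main_def])
        (auto simp: wp_simps enc_bool_eqs T_entails_time_def intro!: calls computesD[OF evaluate])
  qed
qed

lemma T_entails_main_correct:
  assumes "clause_on \<alpha> (Or (fset_of_list ls))" "distinct ls"
  defines "n \<equiv> dag_size \<psi> + dag_size (Or (fset_of_list ls))"
  shows "computes T_entails_main Main [enc_dag ns, enc_literals ls]
    (enc_bool (T_entails T \<psi> (Or (fset_of_list ls)))) (T_entails_time n n)"
proof -
  have literals: "\<forall>l \<in> set ls. is_literal l" "\<And>l. l \<in> set ls \<Longrightarrow> atoms l \<subseteq> \<alpha>"
    using assms(1) by (auto simp: clause_on_def fset_of_list.rep_eq)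
  have "length ls \<le> n"
    using length_children_le_dag_size[OF assms(2), of "Or (fset_of_list ls)"]
    by (simp add: n_def fset_of_list.rep_eq)
  then have time: "T_entails_time (dag_size \<psi>) (length ls) \<le> T_entails_time n n"
    unfolding T_entails_time_def
    by (intro add_le_mono mult_le_mono sat_time_mono) (simp_all add: n_def)
  have entails: "T_entails T \<psi> (Or (fset_of_list ls)) \<longleftrightarrow>
      \<not> satisfiable_with (complement ` set ls) \<psi>"
    using literals(2) by (rule T_entails_clause_iff)
  show ?thesis
    unfolding entails using T_entails_main_evaluates[OF literals(1)] time by (rule computes_mono)
qed

lemma count_SMT_main_correct:
  assumes "distinct as" "set as = \<alpha>"
  shows "computes count_SMT_main Main [enc_dag ns, enc_atoms as] (enc_binary (count_SMT T \<alpha> \<psi>))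
    (count_SMT_time (dag_size \<psi> + card (\<alpha> - atoms \<psi>)))"
proof -
  define n where "n = dag_size \<psi> + card (\<alpha> - atoms \<psi>)"
  have "length as \<le> n"
    using length_le_dag_size_plus_free_atoms[OF assms(1), of \<psi>] assms(2) atoms_subset
    by (simp add: n_def)
  then have time: "count_time (dag_size \<psi>) (length as) \<le> count_time n n"
    by (intro count_time_mono) (simp_all add: n_def)
  have "evaluates count_SMT_main (count_ctx as) ns
      (enc_binary (count_SMT T \<alpha> \<psi>)) (count_time (dag_size \<psi>) (length as))"
    using Evaluate_count_correct[OF d_DNNF listing assms(1), of count_SMT_main]
      assms(2) atoms_subset
    by (simp add: count_SMT_def card_H_assignments)
  with time show ?thesis unfolding n_def[symmetric]
    by (intro computes_MainI[OF count_SMT_main_def])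
      (auto simp: wp_simps count_SMT_time_def enc_bool_eqs elim!: computesD)
qed

lemma presents_conjunctions_AllSMT:
  assumes "distinct as" "set as = \<alpha>"
  shows "presents_conjunctions (enc_list (map enc_literals (extensions \<psi> as []))) (AllSMT T \<alpha> \<psi>)"
  using presents_conjunctions_extensions[OF assms(1), of \<psi>]
  by (simp add: AllSMT_def H_assignments_eq assms(2))

lemma length_extensions_AllSMT:
  "set as = \<alpha> \<Longrightarrow> length (extensions \<psi> as []) = card (AllSMT T \<alpha> \<psi>)"
  using length_extensions_Nil[of \<psi> as] by (simp add: AllSMT_def H_assignments_eq)

lemma length_le_dag_size_plus_AllSMT:
  assumes "distinct as" "set as = \<alpha>" "sat v \<psi>"
  shows "length as \<le> dag_size \<psi> + card (AllSMT T \<alpha> \<psi>)"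
  using length_le_dag_size_plus_free_atoms[OF assms(1), of \<psi>] assms(2) atoms_subset
    card_free_atoms_le_models[OF finite_atoms assms(3) atoms_subset]
  by (simp add: AllSMT_def card_H_assignments)

lemma Enumerate_AllSMT_correct:
  assumes "distinct as" "set as = \<alpha>"
  defines "n \<equiv> dag_size \<psi> + card (AllSMT T \<alpha> \<psi>)"
  shows "computes main Enumerate [enc_dag ns, enc_atoms as, NilD, NilD]
    (enc_list (map enc_literals (extensions \<psi> as []))) ((sat_time n n + 80) * (1 + 2 * n * n))"
proof (cases "satisfiable_with {} \<psi>")
  case False
  then have "extensions \<psi> as [] = []" by (cases as) simp_all
  with False Enumerate_unsatisfiable_correct[OF d_DNNF listing, of "[]" main as NilD]
  have "computes main Enumerate [enc_dag ns, enc_atoms as, NilD, NilD]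
      (enc_list (map enc_literals (extensions \<psi> as []))) (sat_time (dag_size \<psi>) 0 + 80)"
    by (simp add: partial_assignment_empty)
  moreover have "(sat_time (dag_size \<psi>) 0 + 80) * 1 \<le> (sat_time n n + 80) * (1 + 2 * n * n)"
    by (intro mult_le_mono add_le_mono sat_time_mono) (simp_all add: n_def)
  ultimately show ?thesis by (auto elim: computes_mono)
next
  case True
  then obtain v where "sat v \<psi>" by (auto simp: satisfiable_with_def)
  then have as: "length as \<le> n"
    unfolding n_def using assms(1,2) by (intro length_le_dag_size_plus_AllSMT)
  have "computes main Enumerate [enc_dag ns, enc_atoms as, NilD, NilD]
      (enc_list (map enc_literals (extensions \<psi> as [])))
      ((sat_time (dag_size \<psi>) (length as) + 80) * extension_calls \<psi> as [])"
    using Enumerate_correct[OF d_DNNF listing assms(1), of "[]" main "[]"]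
    by (simp add: partial_assignment_empty)
  moreover have "extension_calls \<psi> as [] \<le> 1 + 2 * n * n"
  proof -
    have "extension_calls \<psi> as [] \<le> 1 + 2 * length as * length (extensions \<psi> as [])"
      by (rule extension_calls_le)
    also have "\<dots> \<le> 1 + 2 * n * n"
      unfolding length_extensions_AllSMT[OF assms(2)] using as
      by (intro add_le_mono mult_le_mono) (simp_all add: n_def)
    finally show ?thesis .
  qed
  then have "(sat_time (dag_size \<psi>) (length as) + 80) * extension_calls \<psi> as []
      \<le> (sat_time n n + 80) * (1 + 2 * n * n)"
    using as by (intro mult_le_mono add_le_mono sat_time_mono) (simp_all add: n_def)
  ultimately show ?thesis by (rule computes_mono)
qed

lemma AllSMT_main_correct:
  assumes "distinct as" "set as = \<alpha>"
  shows "computes AllSMT_main Main [enc_dag ns, enc_atoms as]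
    (enc_list (map enc_literals (extensions \<psi> as [])))
    (AllSMT_time (dag_size \<psi> + card (AllSMT T \<alpha> \<psi>)))"
  using Enumerate_AllSMT_correct[OF assms, of AllSMT_main]
  by (intro computes_MainI[OF AllSMT_main_def])
    (auto simp: wp_simps AllSMT_time_def elim!: computesD)

end

theorem theorem5p2:
  fixes T :: "('m, 't) smt_theory"
  shows
    "(\<exists>prg p. \<forall>(\<psi> :: ('t, 'b) atom form) \<alpha> ns.
        d_DNNF \<psi> \<and> finite \<alpha> \<and> atoms \<psi> \<subseteq> \<alpha> \<and> T_reduced T \<alpha> \<psi> \<and> dag_listing \<psi> ns \<longrightarrow>
        outputs_within prg [enc_dag ns] (enc_bool (T_sat T \<psi>)) (poly p (dag_size \<psi>)))
   \<and> (\<exists>prg p. \<forall>(\<psi> :: ('t, 'b) atom form) \<alpha> ns \<beta> ls.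
        d_DNNF \<psi> \<and> finite \<alpha> \<and> atoms \<psi> \<subseteq> \<alpha> \<and> T_reduced T \<alpha> \<psi> \<and> dag_listing \<psi> ns \<and>
        clause_on \<alpha> \<beta> \<and> distinct ls \<and> \<beta> = Or (fset_of_list ls) \<longrightarrow>
        outputs_within prg [enc_dag ns, enc_literals ls] (enc_bool (T_entails T \<psi> \<beta>))
          (poly p (dag_size \<psi> + dag_size \<beta>)))
   \<and> (\<exists>prg p. \<forall>(\<psi> :: ('t, 'b) atom form) \<alpha> ns as.
        d_DNNF \<psi> \<and> finite \<alpha> \<and> atoms \<psi> \<subseteq> \<alpha> \<and> T_reduced T \<alpha> \<psi> \<and> dag_listing \<psi> ns \<and>
        distinct as \<and> set as = \<alpha> \<longrightarrow>
        outputs_within prg [enc_dag ns, enc_atoms as] (enc_binary (count_SMT T \<alpha> \<psi>))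
          (poly p (dag_size \<psi> + card (\<alpha> - atoms \<psi>))))
   \<and> (\<exists>prg p. \<forall>(\<psi> :: ('t, 'b) atom form) \<alpha> ns as.
        d_DNNF \<psi> \<and> finite \<alpha> \<and> atoms \<psi> \<subseteq> \<alpha> \<and> T_reduced T \<alpha> \<psi> \<and> dag_listing \<psi> ns \<and>
        distinct as \<and> set as = \<alpha> \<longrightarrow>
        (\<exists>out. presents_conjunctions out (AllSMT T \<alpha> \<psi>) \<and>
          outputs_within prg [enc_dag ns, enc_atoms as] out
            (poly p (dag_size \<psi> + card (AllSMT T \<alpha> \<psi>)))))"
    (is "?sat \<and> ?entails \<and> ?count \<and> ?all")
proof (intro conjI)
  obtain p_sat p_entails p_count p_all where polys:
    "poly p_sat = T_sat_time" "poly p_entails = (\<lambda>n. T_entails_time n n)"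
    "poly p_count = count_SMT_time" "poly p_all = AllSMT_time"
    using is_polynomial_query_times unfolding is_polynomial_def by metis
  have dag: "T_reduced_dag T \<alpha> \<psi> ns"
    if "d_DNNF \<psi>" "finite \<alpha>" "atoms \<psi> \<subseteq> \<alpha>" "T_reduced T \<alpha> \<psi>" "dag_listing \<psi> ns" for \<alpha> \<psi> ns
    using that by unfold_locales
  show ?sat
    by (rule exI[of _ "program T_sat_main"], rule exI[of _ p_sat])
      (auto simp: polys intro!: outputs_within_program T_reduced_dag.T_sat_main_correct dag)
  show ?entails
    by (rule exI[of _ "program T_entails_main"], rule exI[of _ p_entails])
      (auto simp: polys intro!: outputs_within_program
        T_reduced_dag.T_entails_main_correct dag)
  show ?count
    by (rule exI[of _ "program count_SMT_main"], rule exI[of _ p_count])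
      (auto simp: polys intro!: outputs_within_program T_reduced_dag.count_SMT_main_correct dag)
  show ?all
    by (rule exI[of _ "program AllSMT_main"], rule exI[of _ p_all])
      (auto simp: polys intro!: outputs_within_program T_reduced_dag.AllSMT_main_correct
        T_reduced_dag.presents_conjunctions_AllSMT dag)
qed

end
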